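(* Let $v,w,u$ be vertices of $X(\mathcal G)$ and let $p$ be a vertex on the geodesic from $v$ to $w$ with $p\ne v$ and $p\ne w$. Then $$d_{at}(u,p)\le \max\{d_{at}(u,v),d_{at}(u,w)\},\qquad d_{wd}(u,p)<\max\{d_{wd}(u,v),d_{wd}(u,w)\},$$ and moreover $$d_{wd}(u,p)\le \max\{d_{wd}(u,v),d_{wd}(u,w)\}-\min\{d_{at}(v,p),d_{at}(w,p)\}.$$
   Context: Let $S$ be a finite set and $m$ a Coxeter matrix on $S$ whose Coxeter group $\mathcal W=\langle S\mid (ss')^{m(s,s')}=1\rangle$ is finite; $\mathcal A=\langle S\mid ss's\cdots=s'ss'\cdots\ (m(s,s')\text{ letters each side})\rangle$ is the associated Artin group of finite type, $\mathcal A^+$ the submonoid generated by $S$, and $x<y$ means $y=xz$ with $z\in\mathcal A^+$. An atom is an element of $\mathcal A^+$ whose $S$-word length equals the word length of its image in $\mathcal W$; $\Delta$ is the atom mapping to the longest element of $\mathcal W$ ($\Delta^2$ is central). For $g\in\mathcal A^+$, $\alpha(g)$ is the unique atom with $\alpha(g)<g$ and $A<\alpha(g)$ for all atoms $A<g$; the normal form of $g$ is $g=A_1\cdot\ldots\cdot A_k$ with nontrivial atoms $A_i=\alpha(A_i\cdots A_k)$ (any $\Delta$'s occur first). Let $\mathcal G=\mathcal A/\langle\Delta^2\rangle$, $V=\mathcal A/\langle\Delta\rangle$ (left cosets, acted on by $\mathcal G$ on the left), $*=\langle\Delta\rangle$. Each $v\in V$ has a unique special representative in $\mathcal A^+$ whose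 normal form contains no $\Delta$; its number of atoms is the atomnorm $|v|$ and its word length is the wordnorm $\|v\|$. For $g\in\mathcal G$ with $g( * )=v$ put $d_{at}(v,w)=|g^{-1}w|$ and $d_{wd}(v,w)=\|g^{-1}w\|$ (well-defined, left-invariant; $d_{wd}$ need not be symmetric). $X(\mathcal G)$ is the simplicial complex on $V$ whose simplices are the finite sets of vertices pairwise at $d_{at}=1$. Geodesics: if the special representative of $v$ has normal form $B_1\cdot\ldots\cdot B_k$, the geodesic from $*$ to $v$ is the edge path through $*,B_1\langle\Delta\rangle,B_1B_2\langle\Delta\rangle,\dots,B_1\cdots B_k\langle\Delta\rangle=v$; the geodesic from $v$ to $w$ is the image under $g$ of the geodesic from $*$ to $g^{-1}w$, where $g( * )=v$ (this is well defined). *)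

theory Defs
  imports Main
begin

text \<open>A Coxeter matrix on the finite set S (all entries finite; this is automatic
  when the Coxeter group is finite).\<close>
definition coxeter_matrix :: "'a set \<Rightarrow> ('a \<Rightarrow> 'a \<Rightarrow> nat) \<Rightarrow> bool" where
  "coxeter_matrix S m \<longleftrightarrow>
     (\<forall>s\<in>S. m s s = 1) \<and>
     (\<forall>s\<in>S. \<forall>t\<in>S. s \<noteq> t \<longrightarrow> m s t = m t s \<and> m s t \<ge> 2)"

definition alt :: "'a \<Rightarrow> 'a \<Rightarrow> nat \<Rightarrow> 'a list" where
  "alt s t n = map (\<lambda>i. if even i then s else t) [0..<n]"

inductive cox_eq :: "'a set \<Rightarrow> ('a \<Rightarrow> 'a \<Rightarrow> nat) \<Rightarrow> 'a list \<Rightarrow> 'a list \<Rightarrow> bool"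
  for S m where
  cox_refl: "cox_eq S m w w"
| cox_sym: "cox_eq S m u w \<Longrightarrow> cox_eq S m w u"
| cox_trans: "cox_eq S m u v \<Longrightarrow> cox_eq S m v w \<Longrightarrow> cox_eq S m u w"
| cox_sq: "s \<in> S \<Longrightarrow> cox_eq S m (u @ [s, s] @ v) (u @ v)"
| cox_braid: "s \<in> S \<Longrightarrow> t \<in> S \<Longrightarrow>
     cox_eq S m (u @ alt s t (m s t) @ v) (u @ alt t s (m s t) @ v)"

definition finite_coxeter :: "'a set \<Rightarrow> ('a \<Rightarrow> 'a \<Rightarrow> nat) \<Rightarrow> bool" where
  "finite_coxeter S m \<longleftrightarrow>
     finite {{w'. set w' \<subseteq> S \<and> cox_eq S m w w'} | w. set w \<subseteq> S}"

definition cox_len :: "'a set \<Rightarrow> ('a \<Rightarrow> 'a \<Rightarrow> nat) \<Rightarrow> 'a list \<Rightarrow> nat" where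
  "cox_len S m w = (LEAST n. \<exists>w'. cox_eq S m w w' \<and> length w' = n)"

text \<open>Group words: letters (s, True) = s, (s, False) = s^-1.\<close>
type_synonym 'a gword = "('a \<times> bool) list"

definition gword :: "'a set \<Rightarrow> 'a gword \<Rightarrow> bool" where
  "gword S a \<longleftrightarrow> set (map fst a) \<subseteq> S"

definition pos :: "'a list \<Rightarrow> 'a gword" where
  "pos w = map (\<lambda>x. (x, True)) w"

definition inv_word :: "'a gword \<Rightarrow> 'a gword" where
  "inv_word a = rev (map (\<lambda>(s, b). (s, \<not> b)) a)"

inductive art_eq :: "'a set \<Rightarrow> ('a \<Rightarrow> 'a \<Rightarrow> nat) \<Rightarrow> 'a gword \<Rightarrow> 'a gword \<Rightarrow> bool"
  for S m where
  art_refl: "art_eq S m w w"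
| art_sym: "art_eq S m u w \<Longrightarrow> art_eq S m w u"
| art_trans: "art_eq S m u v \<Longrightarrow> art_eq S m v w \<Longrightarrow> art_eq S m u w"
| art_cancel: "s \<in> S \<Longrightarrow> art_eq S m (u @ [(s, b), (s, \<not> b)] @ v) (u @ v)"
| art_braid: "s \<in> S \<Longrightarrow> t \<in> S \<Longrightarrow>
     art_eq S m (u @ pos (alt s t (m s t)) @ v) (u @ pos (alt t s (m s t)) @ v)"

text \<open>Elements of A^+ are represented by positive words over S; their word length
  is the length of the word. x < y iff y = x z in A with z in A^+.\<close>
definition le_pos :: "'a set \<Rightarrow> ('a \<Rightarrow> 'a \<Rightarrow> nat) \<Rightarrow> 'a list \<Rightarrow> 'a list \<Rightarrow> bool" where
  "le_pos S m x y \<longleftrightarrow> (\<exists>z. set z \<subseteq> S \<and> art_eq S m (pos y) (pos x @ pos z))"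

definition atom :: "'a set \<Rightarrow> ('a \<Rightarrow> 'a \<Rightarrow> nat) \<Rightarrow> 'a list \<Rightarrow> bool" where
  "atom S m x \<longleftrightarrow> set x \<subseteq> S \<and> length x = cox_len S m x"

definition Delta :: "'a set \<Rightarrow> ('a \<Rightarrow> 'a \<Rightarrow> nat) \<Rightarrow> 'a list" where
  "Delta S m = (SOME x. atom S m x \<and> (\<forall>w. set w \<subseteq> S \<longrightarrow> cox_len S m w \<le> cox_len S m x))"

definition delta_pow :: "'a set \<Rightarrow> ('a \<Rightarrow> 'a \<Rightarrow> nat) \<Rightarrow> int \<Rightarrow> 'a gword" where
  "delta_pow S m k =
     (if k \<ge> 0 then concat (replicate (nat k) (pos (Delta S m)))
      else concat (replicate (nat (- k)) (inv_word (pos (Delta S m)))))"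

definition is_alpha :: "'a set \<Rightarrow> ('a \<Rightarrow> 'a \<Rightarrow> nat) \<Rightarrow> 'a list \<Rightarrow> 'a list \<Rightarrow> bool" where
  "is_alpha S m a g \<longleftrightarrow> atom S m a \<and> le_pos S m a g \<and>
     (\<forall>b. atom S m b \<and> le_pos S m b g \<longrightarrow> le_pos S m b a)"

definition is_nf :: "'a set \<Rightarrow> ('a \<Rightarrow> 'a \<Rightarrow> nat) \<Rightarrow> 'a list list \<Rightarrow> bool" where
  "is_nf S m As \<longleftrightarrow> (\<forall>i<length As. As ! i \<noteq> [] \<and> is_alpha S m (As ! i) (concat (drop i As)))"

text \<open>Group words x, y represent the same left coset (vertex) x<Delta> = y<Delta>.\<close>
definition coset_eq :: "'a set \<Rightarrow> ('a \<Rightarrow> 'a \<Rightarrow> nat) \<Rightarrow> 'a gword \<Rightarrow> 'a gword \<Rightarrow> bool" where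
  "coset_eq S m x y \<longleftrightarrow> (\<exists>k. art_eq S m y (x @ delta_pow S m k))"

definition special_nf :: "'a set \<Rightarrow> ('a \<Rightarrow> 'a \<Rightarrow> nat) \<Rightarrow> 'a gword \<Rightarrow> 'a list list \<Rightarrow> bool" where
  "special_nf S m x As \<longleftrightarrow> is_nf S m As \<and>
     (\<forall>i<length As. \<not> art_eq S m (pos (As ! i)) (pos (Delta S m))) \<and>
     coset_eq S m x (pos (concat As))"

definition atomnorm :: "'a set \<Rightarrow> ('a \<Rightarrow> 'a \<Rightarrow> nat) \<Rightarrow> 'a gword \<Rightarrow> nat" where
  "atomnorm S m x = length (SOME As. special_nf S m x As)"

definition wordnorm :: "'a set \<Rightarrow> ('a \<Rightarrow> 'a \<Rightarrow> nat) \<Rightarrow> 'a gword \<Rightarrow> nat" where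
  "wordnorm S m x = length (concat (SOME As. special_nf S m x As))"

text \<open>Distances between the vertices a<Delta> and b<Delta> (g = a satisfies g(*) = a<Delta>).\<close>
definition d_at :: "'a set \<Rightarrow> ('a \<Rightarrow> 'a \<Rightarrow> nat) \<Rightarrow> 'a gword \<Rightarrow> 'a gword \<Rightarrow> nat" where
  "d_at S m a b = atomnorm S m (inv_word a @ b)"

definition d_wd :: "'a set \<Rightarrow> ('a \<Rightarrow> 'a \<Rightarrow> nat) \<Rightarrow> 'a gword \<Rightarrow> 'a gword \<Rightarrow> nat" where
  "d_wd S m a b = wordnorm S m (inv_word a @ b)"

end

theory Submission
  imports Defs Complex_Main
begin

text \<open>Move u to \<open>*\<close>, so that the vertices of the geodesic are
  \<open>g B\<^sub>1 \<cdots> B\<^sub>j\<langle>\<Delta>\<rangle>\<close> with g positive and not divisible by \<open>\<Delta>\<close>. Since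
  \<open>\<alpha>(x y) = \<alpha>(x \<alpha>(y))\<close>, as soon as one step does not increase the power of \<open>\<Delta>\<close> dividing
  \<open>g B\<^sub>1 \<cdots> B\<^sub>j\<close>, no later step does. A step that gains a \<open>\<Delta>\<close> strictly lowers the wordnorm
  and does not raise the atomnorm; a step that does not gain one strictly raises the wordnorm and
  does not lower the atomnorm. So both norms first fall and then rise along the geodesic.

  The atoms are controlled through the geometric representation: the sign of a root decides
  whether the length goes up, so an element with two right descents s and t is divisible by their
  lcm, which yields Matsumoto's theorem. A bounded prefix-closed set of atoms that is closed under
  such lcms has a greatest element; this yields \<open>\<Delta>\<close> and \<open>\<alpha>\<close>.\<close>

section \<open>Coxeter groups\<close>

text \<open>The margin in the last inequality counts steps. If the i steps from v to p all gain a
  \<Delta>, each costs at least one letter, because every atom on the geodesic is shorter than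
  \<Delta>; otherwise each of the k - i steps from p to w adds a nonempty atom. These numbers bound
  d_at(v,p) and d_at(w,p), the latter because k - i atoms can be inverted up to \<Delta> by k - i
  complements. The obstacle is that divisibility, normal forms and cosets are defined in the group,
  whereas \<alpha> is found in the monoid, whose embedding and cancellation have to be proved. Only
  atoms inherit cancellation from the Coxeter group, so \<alpha> and its remaining factor are built
  from atoms alone. The remaining factor is an invariant of the braid class and equals z on \<Delta>
  z, so it makes \<Delta> cancellable; every letter divides \<Delta>, so all words are.\<close>

lemma alt_0 [simp]: "alt s t 0 = []"
  by (simp add: alt_def)

lemma length_alt [simp]: "length (alt s t k) = k"
  by (simp add: alt_def)

lemma alt_snoc: "alt s t (Suc k) = alt s t k @ [if even k then s else t]"
  by (simp add: alt_def)

lemma alt_Cons: "alt s t (Suc k) = s # alt t s k"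
  by (simp add: alt_def upt_conv_Cons map_Suc_upt[symmetric] del: upt_Suc)

lemma set_alt: "s \<in> S \<Longrightarrow> t \<in> S \<Longrightarrow> set (alt s t k) \<subseteq> S"
  by (auto simp: alt_def)

lemma rev_alt: "rev (alt s t k) = (if even k then alt t s k else alt s t k)"
proof (induction k arbitrary: s t)
  case (Suc k)
  have "rev (alt s t (Suc k)) = rev (alt t s k) @ [s]"
    by (simp add: alt_Cons)
  then show ?case
    by (simp add: Suc alt_snoc)
qed simp

lemma alt_same: "alt s s k = replicate k s"
  by (simp add: alt_def map_replicate_const)

inductive br_eq :: "'a set \<Rightarrow> ('a \<Rightarrow> 'a \<Rightarrow> nat) \<Rightarrow> 'a list \<Rightarrow> 'a list \<Rightarrow> bool"
  for S m where
  br_refl: "br_eq S m w w"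
| br_sym: "br_eq S m u w \<Longrightarrow> br_eq S m w u"
| br_trans: "br_eq S m u v \<Longrightarrow> br_eq S m v w \<Longrightarrow> br_eq S m u w"
| br_braid: "s \<in> S \<Longrightarrow> t \<in> S \<Longrightarrow>
     br_eq S m (u @ alt s t (m s t) @ v) (u @ alt t s (m s t) @ v)"

text \<open>The contragredient of the geometric representation: a functional on the span of
  the simple roots is given by its values on them.\<close>
definition reflect :: "('a \<Rightarrow> 'a \<Rightarrow> nat) \<Rightarrow> 'a \<Rightarrow> ('a \<Rightarrow> real) \<Rightarrow> 'a \<Rightarrow> real" where
  "reflect m s f = (\<lambda>r. f r + 2 * cos (pi / real (m s r)) * f s)"

text \<open>As \<open>foldl\<close> composes on the right, \<open>act m f w\<close> is f after the
  group element w: its value at r is f applied to the image under w of the simple root of r.\<close>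

definition act :: "('a \<Rightarrow> 'a \<Rightarrow> nat) \<Rightarrow> ('a \<Rightarrow> real) \<Rightarrow> 'a list \<Rightarrow> 'a \<Rightarrow> real" where
  "act m f w = foldl (\<lambda>f s. reflect m s f) f w"

lemma act_Nil [simp]: "act m f [] = f"
  by (simp add: act_def)

lemma act_append [simp]: "act m f (u @ v) = act m (act m f u) v"
  by (simp add: act_def)

lemma act_Cons [simp]: "act m f (s # v) = act m (reflect m s f) v"
  by (simp add: act_def)

locale coxeter =
  fixes S :: "'a set" and m :: "'a \<Rightarrow> 'a \<Rightarrow> nat"
  assumes coxeter_matrix: "coxeter_matrix S m"
begin

abbreviation cox (infix "\<sim>" 50) where "u \<sim> v \<equiv> cox_eq S m u v"
abbreviation br (infix "\<approx>" 50) where "u \<approx> v \<equiv> br_eq S m u v"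
abbreviation len where "len \<equiv> cox_len S m"
abbreviation Wd where "Wd \<equiv> lists S"

declare cox_trans [trans] br_trans [trans]
declare cox_refl [simp, intro] br_refl [simp, intro]

lemma m_self: "s \<in> S \<Longrightarrow> m s s = 1"
  and m_sym: "s \<in> S \<Longrightarrow> t \<in> S \<Longrightarrow> m s t = m t s"
  and m_ge_2: "s \<in> S \<Longrightarrow> t \<in> S \<Longrightarrow> s \<noteq> t \<Longrightarrow> m s t \<ge> 2"
  using coxeter_matrix unfolding coxeter_matrix_def by metis+

lemma alt_in_lists [simp, intro]: "s \<in> S \<Longrightarrow> t \<in> S \<Longrightarrow> alt s t k \<in> Wd"
  using set_alt by fastforce

section \<open>Congruence, inverses and length in the Coxeter group\<close>

lemma cox_context: "u \<sim> v \<Longrightarrow> x @ u @ y \<sim> x @ v @ y"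
proof (induction rule: cox_eq.induct)
  case (cox_sq s u v)
  then show ?case using cox_eq.cox_sq[of s S m "x @ u" "v @ y"] by simp
next
  case (cox_braid s t u v)
  then show ?case using cox_eq.cox_braid[of s S t m "x @ u" "v @ y"] by simp
qed (auto intro: cox_sym cox_trans)

lemma cox_cong: "u \<sim> u' \<Longrightarrow> v \<sim> v' \<Longrightarrow> u @ v \<sim> u' @ v'"
  using cox_context[of u u' "[]" v] cox_context[of v v' u' "[]"]
  by (auto intro: cox_trans)

lemma cox_in_lists: "u \<sim> v \<Longrightarrow> u \<in> Wd \<longleftrightarrow> v \<in> Wd"
  by (induction rule: cox_eq.induct) auto

lemma cox_even: "u \<sim> v \<Longrightarrow> even (length u) = even (length v)"
  by (induction rule: cox_eq.induct) auto

lemma cox_rev: "u \<sim> v \<Longrightarrow> rev u \<sim> rev v"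
proof (induction rule: cox_eq.induct)
  case (cox_sq s u v)
  then show ?case using cox_eq.cox_sq[of s S m "rev v" "rev u"] by simp
next
  case (cox_braid s t u v)
  then show ?case
    using cox_eq.cox_braid[of s S t m "rev v" "rev u"] cox_eq.cox_braid[of t S s m "rev v" "rev u"]
    by (auto simp: rev_alt m_sym[of t s])
qed (auto intro: cox_sym cox_trans)

lemma cox_right_inverse: "w \<in> Wd \<Longrightarrow> w @ rev w \<sim> []"
proof (induction w rule: rev_induct)
  case (snoc s w)
  then have "w @ [s, s] @ rev w \<sim> w @ rev w"
    by (intro cox_sq) auto
  with snoc show ?case by (auto intro: cox_trans)
qed simp

lemma cox_left_inverse: "w \<in> Wd \<Longrightarrow> rev w @ w \<sim> []"
  using cox_right_inverse[of "rev w"] by (simp add: in_lists_conv_set)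

lemma cox_move: "v \<in> Wd \<Longrightarrow> u @ v \<sim> w \<Longrightarrow> u \<sim> w @ rev v"
proof -
  assume v: "v \<in> Wd" and *: "u @ v \<sim> w"
  have "u \<sim> u @ v @ rev v"
    using cox_context[OF cox_right_inverse[OF v], of u "[]"] by (auto intro: cox_sym)
  also have "\<dots> \<sim> w @ rev v"
    using cox_cong[OF * cox_refl, of "rev v"] by simp
  finally show ?thesis .
qed

lemma cox_left_cancel: "x \<in> Wd \<Longrightarrow> x @ u \<sim> x @ v \<Longrightarrow> u \<sim> v"
proof -
  assume x: "x \<in> Wd" and *: "x @ u \<sim> x @ v"
  have c: "rev x @ x @ z \<sim> z" for z
    using cox_cong[OF cox_left_inverse[OF x] cox_refl, of z] by simp
  show ?thesis
    using c[of u] c[of v] cox_context[OF *, of "rev x" "[]"] by (auto intro: cox_sym cox_trans)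
qed

lemma len_le: "w \<sim> w' \<Longrightarrow> len w \<le> length w'"
  unfolding cox_len_def by (rule Least_le) auto

lemma len_witness: obtains w' where "w \<sim> w'" "length w' = len w"
proof -
  have "\<exists>w'. w \<sim> w' \<and> length w' = len w"
    unfolding cox_len_def by (rule LeastI[of _ "length w"]) auto
  with that show ?thesis by blast
qed

lemma len_cong: "u \<sim> v \<Longrightarrow> len u = len v"
  by (metis cox_sym cox_trans len_le len_witness order_antisym)

lemma len_even: "even (len w) = even (length w)"
  by (metis cox_even len_witness)

lemma len_append: "len (u @ v) \<le> len u + len v"
proof -
  obtain u' v' where "u \<sim> u'" "length u' = len u" "v \<sim> v'" "length v' = len v"
    by (metis len_witness)
  then show ?thesis using len_le[OF cox_cong[of u u' v v']] by simp
qed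

lemma len_rev: "len (rev w) = len w"
proof -
  have "len (rev w) \<le> len w" for w
    by (metis cox_rev len_le len_witness length_rev)
  from this[of w] this[of "rev w"] show ?thesis by simp
qed

lemma len_snoc_bound: assumes "s \<in> S" shows "len w \<le> len (w @ [s]) + 1"
proof -
  have "len w = len ((w @ [s]) @ [s])"
    using cox_sq[of s S m w "[]"] assms by (auto intro: len_cong cox_sym)
  also have "\<dots> \<le> len (w @ [s]) + len [s]" by (rule len_append)
  finally show ?thesis using len_le[of "[s]" "[s]"] by auto
qed

lemma len_snoc: assumes "s \<in> S"
  shows "len (w @ [s]) = len w + 1 \<or> len w = len (w @ [s]) + 1"
proof -
  have "len (w @ [s]) \<noteq> len w" using len_even[of w] len_even[of "w @ [s]"] by auto
  moreover have "len (w @ [s]) \<le> len w + 1"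
    using len_append[of w "[s]"] len_le[of "[s]" "[s]"] by auto
  ultimately show ?thesis using len_snoc_bound[OF assms, of w] by linarith
qed

lemma atom_iff: "atom S m x \<longleftrightarrow> x \<in> Wd \<and> length x = len x"
  by (auto simp: atom_def)

lemma atom_cong: "x \<sim> y \<Longrightarrow> length x = length y \<Longrightarrow> atom S m x \<Longrightarrow> atom S m y"
  unfolding atom_iff using cox_in_lists len_cong by auto

lemma atom_append: assumes "atom S m (x @ y)" shows "atom S m x" "atom S m y"
  using assms len_append[of x y] len_le[of x x] len_le[of y y] unfolding atom_iff by auto

lemma atom_witness: assumes "w \<in> Wd" obtains x where "atom S m x" "w \<sim> x"
  by (metis assms atom_iff cox_in_lists len_cong len_witness)

section \<open>The geometric representation respects the Coxeter relations\<close>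

lemma act_square: "s \<in> S \<Longrightarrow> act m f [s, s] = f"
  by (auto simp: reflect_def m_self fun_eq_iff)

lemma angle:
  assumes "s \<in> S" "t \<in> S" "s \<noteq> t"
  shows "sin (pi / real (m s t)) > 0" "real (m s t) * (pi / real (m s t)) = pi"
  using m_ge_2[OF assms] by (auto intro!: sin_gt_zero simp: field_simps)

text \<open>Appending the next letter negates the value there and adds 2 cos \<theta> times the old
  one to the other value. Sines of multiples of \<theta> solve this recursion; the factor sin
  \<theta> avoids a quotient. The conditional selects the letter that comes next. At k = 0 the
  multiple k - 1 really is -1, hence the reals.\<close>

lemma act_alt:
  fixes k :: nat and f :: "'a \<Rightarrow> real"
  assumes st: "s \<in> S" "t \<in> S" "s \<noteq> t"
  defines "\<theta> \<equiv> pi / real (m s t)"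
  defines "g \<equiv> act m f (alt s t k)"
  shows "sin \<theta> * g (if even k then s else t) = sin ((real k + 1) * \<theta>) * f s + sin (real k * \<theta>) * f t
       \<and> sin \<theta> * g (if even k then t else s) = - (sin (real k * \<theta>) * f s + sin ((real k - 1) * \<theta>) * f t)"
  unfolding g_def
proof (induction k)
  case (Suc k)
  let ?g = "act m f (alt s t k)"
  let ?x = "if even k then s else t" and ?y = "if even k then t else s"
  let ?g' = "act m f (alt s t (Suc k))"
  have g': "?g' = reflect m ?x ?g" by (simp add: alt_snoc)
  have x: "?g' ?x = - ?g ?x" using st by (simp add: g' reflect_def m_self)
  have y: "?g' ?y = ?g ?y + 2 * cos \<theta> * ?g ?x"
    using st by (simp add: g' reflect_def \<theta>_def m_sym)
  have rec: "sin ((a + 1) * \<theta>) = 2 * cos \<theta> * sin (a * \<theta>) - sin ((a - 1) * \<theta>)" for a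
    by (simp add: sin_add sin_diff distrib_right left_diff_distrib)
  have "sin \<theta> * ?g' ?y = sin ((real (Suc k) + 1) * \<theta>) * f s + sin (real (Suc k) * \<theta>) * f t"
  proof -
    have "sin \<theta> * ?g' ?y = sin \<theta> * ?g ?y + 2 * cos \<theta> * (sin \<theta> * ?g ?x)"
      unfolding y by (simp add: algebra_simps)
    also have "\<dots> = - (sin (real k * \<theta>) * f s + sin ((real k - 1) * \<theta>) * f t)
        + 2 * cos \<theta> * (sin ((real k + 1) * \<theta>) * f s + sin (real k * \<theta>) * f t)"
      using Suc by metis
    also have "\<dots> = (2 * cos \<theta> * sin ((real k + 1) * \<theta>) - sin ((real k + 1 - 1) * \<theta>)) * f s
        + (2 * cos \<theta> * sin (real k * \<theta>) - sin ((real k - 1) * \<theta>)) * f t"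
      by (simp add: algebra_simps)
    finally show ?thesis
      unfolding rec[symmetric] by (simp add: add.commute)
  qed
  moreover have "sin \<theta> * ?g' ?x = - (sin (real (Suc k) * \<theta>) * f s + sin ((real (Suc k) - 1) * \<theta>) * f t)"
  proof -
    have "sin \<theta> * ?g' ?x = - (sin \<theta> * ?g ?x)" unfolding x by simp
    with Suc show ?thesis by (simp add: add.commute)
  qed
  ultimately show ?case by (cases "even k") simp_all
qed simp

text \<open>At k = m the angle k \<theta> is \<pi>: the longest dihedral element negates the two
  simple roots, and also swaps them when m is odd.\<close>

lemma act_alt_full:
  assumes st: "s \<in> S" "t \<in> S" "s \<noteq> t"
  defines "n \<equiv> m s t"
  shows "act m f (alt s t n) s = - f (if even n then s else t)"
    and "act m f (alt s t n) t = - f (if even n then t else s)"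
proof -
  define \<theta> where "\<theta> = pi / real n"
  have pos: "sin \<theta> > 0" and pi: "real n * \<theta> = pi"
    using angle[OF st] by (auto simp: \<theta>_def n_def)
  have "sin ((real n + 1) * \<theta>) = - sin \<theta>" "sin ((real n - 1) * \<theta>) = sin \<theta>" "sin (real n * \<theta>) = 0"
    using pi by (auto simp: distrib_right left_diff_distrib sin_add sin_diff)
  with act_alt[OF st, of f n, folded n_def, folded \<theta>_def]
  have "sin \<theta> * act m f (alt s t n) (if even n then s else t) = sin \<theta> * (- f s)"
    "sin \<theta> * act m f (alt s t n) (if even n then t else s) = sin \<theta> * (- f t)"
    by auto
  then have "act m f (alt s t n) (if even n then s else t) = - f s"
    "act m f (alt s t n) (if even n then t else s) = - f t"
    using pos by (metis mult_left_cancel less_irrefl)+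
  then show "act m f (alt s t n) s = - f (if even n then s else t)"
    and "act m f (alt s t n) t = - f (if even n then t else s)"
    by (auto split: if_splits)
qed

text \<open>The values at s and t are known from the dihedral computation; the value at any other r
  follows since a suitable combination f r + a f s + b f t is invariant under both s and t.\<close>
lemma act_braid:
  assumes st: "s \<in> S" "t \<in> S"
  shows "act m f (alt s t (m s t)) = act m f (alt t s (m s t))"
proof (cases "s = t")
  case False
  define c where "c = 2 * cos (pi / real (m s t))"
  \<comment> \<open>This is the determinant of the linear system that a and b have to solve.\<close>
  have c4: "4 - c\<^sup>2 > 0"
  proof -
    have "4 - c\<^sup>2 = 4 * (sin (pi / real (m s t)))\<^sup>2"
      unfolding c_def by (simp add: power_mult_distrib sin_squared_eq algebra_simps)
    also have "\<dots> > 0" using angle(1)[OF st False] by simp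
    finally show ?thesis .
  qed
  have "act m f (alt s t (m s t)) r = act m f (alt t s (m s t)) r" for r
  proof -
    define p where "p = 2 * cos (pi / real (m s r))"
    define q where "q = 2 * cos (pi / real (m t r))"
    \<comment> \<open>a and b solve \<open>2 * a - c * b = p\<close> and
      \<open>2 * b - c * a = q\<close>, the conditions for h to be invariant under s and t.\<close>
    define a where "a = (2 * p + c * q) / (4 - c\<^sup>2)"
    define b where "b = (2 * q + c * p) / (4 - c\<^sup>2)"
    define h where "h g = g r + a * g s + b * g t" for g :: "'a \<Rightarrow> real"
    have "2 * a - c * b = p * ((4 - c\<^sup>2) / (4 - c\<^sup>2))" "2 * b - c * a = q * ((4 - c\<^sup>2) / (4 - c\<^sup>2))"
      unfolding a_def b_def by (simp_all add: diff_divide_distrib add_divide_distrib field_simps power2_eq_square)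
    with c4 have ab: "p = 2 * a - c * b" "q = 2 * b - c * a" by simp_all
    have hs: "h (reflect m s g) = h g" for g
    proof -
      have "h (reflect m s g) = (g r + p * g s) + a * (- g s) + b * (g t + c * g s)"
        using st by (simp add: h_def reflect_def m_self p_def c_def)
      then show ?thesis by (simp add: ab h_def algebra_simps)
    qed
    have ht: "h (reflect m t g) = h g" for g
    proof -
      have "h (reflect m t g) = (g r + q * g t) + a * (g s + c * g t) + b * (- g t)"
        using st by (simp add: h_def reflect_def m_self q_def c_def m_sym[of t s])
      then show ?thesis by (simp add: ab h_def algebra_simps)
    qed
    have h: "set w \<subseteq> {s, t} \<Longrightarrow> h (act m g w) = h g" for w g
      by (induction w arbitrary: g) (auto simp: hs ht)
    have "h (act m f (alt s t (m s t))) = h (act m f (alt t s (m s t)))"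
      by (subst (1 2) h) (use set_alt[of _ "{s, t}"] in auto)
    then show ?thesis
      using act_alt_full[OF st False, of f] act_alt_full[of t s f] st False
      by (auto simp: h_def m_sym[of t s] split: if_splits)
  qed
  then show ?thesis by auto
qed simp

lemma act_cong: "u \<sim> v \<Longrightarrow> act m f u = act m f v"
proof (induction arbitrary: f rule: cox_eq.induct)
  case (cox_sq s u v)
  then show ?case using act_square[of s "act m f u"] by simp
next
  case (cox_braid s t u v)
  then show ?case by (simp add: act_braid[OF cox_braid])
qed auto

text \<open>Starting from the functional that is 1 on all simple roots, \<open>F w s\<close> is the
  height (coefficient sum) of the root obtained by applying w to the simple root of s.\<close>

abbreviation F where "F \<equiv> act m (\<lambda>_. 1)"

section \<open>Signs of roots decide whether a letter lengthens a word\<close>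

lemma sin_multiple_nonneg:
  assumes "s \<in> S" "t \<in> S" "s \<noteq> t" "k \<le> m s t"
  shows "sin (real k * (pi / real (m s t))) \<ge> 0"
proof (rule sin_ge_zero)
  show "real k * (pi / real (m s t)) \<le> pi"
    using assms m_ge_2[OF assms(1-3)] by (simp add: field_simps)
qed simp

lemma sin_multiple_pos:
  assumes "s \<in> S" "t \<in> S" "s \<noteq> t" "0 < k" "k < m s t"
  shows "sin (real k * (pi / real (m s t))) > 0"
proof (rule sin_gt_zero)
  show "real k * (pi / real (m s t)) < pi" "0 < real k * (pi / real (m s t))"
    using assms m_ge_2[OF assms(1-3)] by (simp_all add: field_simps)
qed

text \<open>For k < m the angles k \<theta> and (k+1) \<theta> lie between 0 and \<pi>, and their
  sines do not both vanish.\<close>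

lemma act_alt_pos:
  assumes st: "s \<in> S" "t \<in> S" "s \<noteq> t" and k: "k < m s t" and f: "f s > 0" "f t > 0"
  shows "act m f (alt s t k) (if even k then s else t) > 0"
proof -
  let ?\<theta> = "pi / real (m s t)"
  have "sin ((real k + 1) * ?\<theta>) \<ge> 0" "sin (real k * ?\<theta>) \<ge> 0"
    using sin_multiple_nonneg[OF st, of "Suc k"] sin_multiple_nonneg[OF st, of k] k by (auto simp: add.commute)
  moreover have "sin ((real k + 1) * ?\<theta>) > 0 \<or> sin (real k * ?\<theta>) > 0"
    using sin_multiple_pos[OF st, of k] angle(1)[OF st] k by (cases "k = 0") auto
  ultimately have "sin ((real k + 1) * ?\<theta>) * f s + sin (real k * ?\<theta>) * f t > 0"
    using f by (auto intro: add_pos_nonneg add_nonneg_pos)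
  then have "sin ?\<theta> * act m f (alt s t k) (if even k then s else t) > 0"
    using act_alt[OF st, of f k] by simp
  with angle(1)[OF st] show ?thesis by (simp add: zero_less_mult_iff)
qed

lemma act_uminus: "act m (\<lambda>r. - f r) w = (\<lambda>r. - act m f w r)"
proof (induction w arbitrary: f)
  case (Cons s w)
  have "reflect m s (\<lambda>r. - f r) = (\<lambda>r. - reflect m s f r)" by (auto simp: reflect_def)
  with Cons show ?case by simp
qed simp

lemma act_alt_neg:
  assumes "s \<in> S" "t \<in> S" "s \<noteq> t" "k < m s t" "f s < 0" "f t < 0"
  shows "act m f (alt s t k) (if even k then s else t) < 0"
  using act_alt_pos[OF assms(1-4), of "\<lambda>r. - f r"] assms by (simp add: act_uminus)

lemma take_alt: "j \<le> k \<Longrightarrow> take j (alt s t k) = alt s t j"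
  by (simp add: alt_def take_map)

text \<open>Write w = v d with d an alternating word in s and t that ends in t and is as long as
  possible. Then v gets longer under s and t, so F v is positive at both, and F w s is a
  nonnegative combination of these two values.\<close>
lemma F_pos:
  assumes "w \<in> Wd" "s \<in> S" "len (w @ [s]) = len w + 1"
  shows "F w s > 0"
  using assms
proof (induction "len w" arbitrary: w s rule: less_induct)
  case less
  note w = less.prems(1) and s = less.prems(2) and up = less.prems(3)
  show ?case
  proof (cases "len w = 0")
    case True
    then have "w \<sim> []" by (metis len_witness length_0_conv)
    then show ?thesis by (simp add: act_cong)
  next
    case False
    obtain w0 where w0: "w \<sim> w0" "length w0 = len w" by (rule len_witness)
    with False obtain w1 t where w1: "w0 = w1 @ [t]" by (metis length_0_conv rev_exhaust)
    have t: "t \<in> S" "w1 \<in> Wd" using w0(1) w w1 cox_in_lists by auto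
    have "t \<noteq> s"
    proof
      assume "t = s"
      then have "w @ [s] \<sim> w1"
        using cox_trans[OF cox_cong[OF w0(1) cox_refl, of "[s]"], of w1] cox_sq[OF s, of m w1 "[]"] w1
        by simp
      then show False using len_le[of "w @ [s]" w1] up w0 w1 by auto
    qed
    define D where "D k v \<longleftrightarrow> v \<in> Wd \<and> w \<sim> v @ rev (alt t s k) \<and> len w = len v + k" for k v
    have "len w1 + 1 = len w"
      using len_append[of w1 "[t]"] len_le[of w1 w1] len_le[of "[t]" "[t]"] len_cong[OF w0(1)] w0 w1 by auto
    then have "D 1 w1" using w0 w1 t by (simp add: D_def alt_def)
    have "k \<le> len w" if "D k v" for k v
      using that unfolding D_def by linarith
    then have "\<exists>k. (\<exists>v. D k v) \<and> (\<forall>k'. (\<exists>v. D k' v) \<longrightarrow> k' \<le> k)"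
      by (intro ex_has_greatest_nat[where k = 1 and b = "Suc (len w)"])
        (use \<open>D 1 w1\<close> in \<open>auto simp: le_imp_less_Suc\<close>)
    then obtain k where k: "\<exists>v. D k v" and max: "\<And>k' v'. D k' v' \<Longrightarrow> k' \<le> k"
      by auto
    with \<open>D 1 w1\<close> have "k \<ge> 1" by blast
    from k obtain v where v: "v \<in> Wd" "w \<sim> v @ rev (alt t s k)" "len w = len v + k"
      by (auto simp: D_def)
    \<comment> \<open>With m letters, the braid relation would turn the suffix into one ending in s,
      and appending s would shorten w.\<close>
    have km: "k < m t s"
    proof (rule ccontr)
      let ?n = "m t s" and ?r = "drop (m t s) (alt t s k)"
      assume "\<not> k < ?n"
      then have split: "alt t s k = alt t s ?n @ ?r" by (metis append_take_drop_id not_less take_alt)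
      have n: "?n = Suc (?n - 1)" using m_ge_2[OF t(1) s \<open>t \<noteq> s\<close>] by simp
      let ?z = "v @ rev ?r @ rev (alt t s (?n - 1))"
      have "rev (alt t s ?n) \<sim> rev (alt s t ?n)"
        using cox_braid[OF t(1) s, of m "[]" "[]"] by (simp add: cox_rev)
      also have "rev (alt s t ?n) = rev (alt t s (?n - 1)) @ [s]"
        by (subst n, subst alt_Cons) simp
      finally have "v @ rev (alt t s k) \<sim> ?z @ [s]"
        using cox_context[of _ _ "v @ rev ?r" "[]"] by (subst split) simp
      then have "w @ [s] \<sim> (?z @ [s]) @ [s]"
        using cox_cong[OF cox_trans[OF v(2)] cox_refl] by blast
      then have "w @ [s] \<sim> ?z" using cox_trans[OF _ cox_sq[OF s, of m ?z "[]"]] by simp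
      then have "len (w @ [s]) = len ?z" by (rule len_cong)
      also have "\<dots> \<le> len v + len (rev ?r @ rev (alt t s (?n - 1)))" by (rule len_append)
      also have "\<dots> \<le> len v + (k - 1)"
        using len_le[OF cox_refl, of "rev ?r @ rev (alt t s (?n - 1))"] \<open>\<not> k < ?n\<close> n by simp
      finally show False using up v(3) by simp
    qed
    \<comment> \<open>A letter that shortens v either prolongs the alternating suffix, against the
      choice of k, or equals its first letter, and moving that into v makes w too short.\<close>
    have up_any: "len (v @ [x]) = len v + 1" if x: "x \<in> {s, t}" for x
    proof (rule ccontr)
      assume "len (v @ [x]) \<noteq> len v + 1"
      with x s t have down: "len v = len (v @ [x]) + 1" using len_snoc[of x v] by auto
      show False
      proof (cases "x = (if even k then t else s)")
        case True
        then have "rev (alt t s (Suc k)) = [x] @ rev (alt t s k)" by (simp add: alt_snoc)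
        then have "v @ rev (alt t s k) \<sim> (v @ [x]) @ rev (alt t s (Suc k))"
          using cox_sq[of x S m v "rev (alt t s k)"] x s t by (auto intro: cox_sym)
        then have "w \<sim> (v @ [x]) @ rev (alt t s (Suc k))" using v(2) cox_trans by blast
        with v down x s t have "D (Suc k) (v @ [x])" by (auto simp: D_def)
        with max show False by fastforce
      next
        case False
        obtain j where j: "k = Suc j" using \<open>k \<ge> 1\<close> by (cases k) auto
        with False x have "rev (alt t s k) = [x] @ rev (alt t s j)"
          by (auto simp: alt_snoc split: if_splits)
        then have "len w = len ((v @ [x]) @ rev (alt t s j))" using len_cong[OF v(2)] by simp
        also have "\<dots> \<le> len (v @ [x]) + len (rev (alt t s j))" by (rule len_append)
        also have "\<dots> \<le> len (v @ [x]) + j" using len_le[OF cox_refl, of "rev (alt t s j)"] by simp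
        finally show False using down v(3) j by simp
      qed
    qed
    have "len v < len w" using v(3) \<open>k \<ge> 1\<close> by simp
    then have Fv: "F v s > 0" "F v t > 0"
      using less.hyps[of v] v(1) s t(1) up_any by auto
    have "act m (F v) (rev (alt t s k)) s > 0"
      using act_alt_pos[OF s t(1), of k "F v"] act_alt_pos[OF t(1) s, of k "F v"] Fv km \<open>t \<noteq> s\<close>
        m_sym[OF s t(1)] by (auto simp: rev_alt split: if_splits)
    then show ?thesis using act_cong[OF v(2)] by simp
  qed
qed

text \<open>Apply \<open>F_pos\<close> to w s, which s lengthens; the last reflection changes the
  sign at s.\<close>

lemma F_neg:
  assumes "w \<in> Wd" "s \<in> S" "len w = len (w @ [s]) + 1"
  shows "F w s < 0"
proof -
  have "len ((w @ [s]) @ [s]) = len w"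
    using len_cong[OF cox_sq[of s S m w "[]"]] assms by simp
  then have "F (w @ [s]) s > 0" using assms by (intro F_pos) auto
  then show ?thesis using assms by (simp add: reflect_def m_self)
qed

text \<open>The two signs at w determine the signs along the whole alternating word: before m
  letters are used up, the value at the next letter stays positive.\<close>

lemma len_alt_up:
  assumes w: "w \<in> Wd" and st: "s \<in> S" "t \<in> S" "s \<noteq> t"
    and up: "len (w @ [s]) = len w + 1" "len (w @ [t]) = len w + 1"
  shows "k \<le> m s t \<Longrightarrow> len (w @ alt s t k) = len w + k"
proof (induction k)
  case (Suc k)
  let ?x = "if even k then s else t"
  have "F (w @ alt s t k) ?x > 0"
    using act_alt_pos[OF st, of k "F w"] F_pos[OF w] st up Suc.prems by simp
  moreover have "len (w @ alt s t k) = len ((w @ alt s t k) @ [?x]) + 1 \<Longrightarrow> F (w @ alt s t k) ?x < 0"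
    using w st by (intro F_neg) auto
  ultimately have "len ((w @ alt s t k) @ [?x]) = len (w @ alt s t k) + 1"
    using len_snoc[of ?x "w @ alt s t k"] st by (auto split: if_splits)
  with Suc show ?case by (simp add: alt_snoc)
qed simp

lemma len_alt_down:
  assumes w: "w \<in> Wd" and st: "s \<in> S" "t \<in> S" "s \<noteq> t"
    and down: "len w = len (w @ [s]) + 1" "len w = len (w @ [t]) + 1"
  shows "k \<le> m s t \<Longrightarrow> len w = len (w @ alt s t k) + k"
proof (induction k)
  case (Suc k)
  let ?x = "if even k then s else t"
  have "F (w @ alt s t k) ?x < 0"
    using act_alt_neg[OF st, of k "F w"] F_neg[OF w] st down Suc.prems by simp
  moreover have "len ((w @ alt s t k) @ [?x]) = len (w @ alt s t k) + 1 \<Longrightarrow> F (w @ alt s t k) ?x > 0"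
    using w st by (intro F_pos) auto
  ultimately have "len (w @ alt s t k) = len ((w @ alt s t k) @ [?x]) + 1"
    using len_snoc[of ?x "w @ alt s t k"] st by (auto split: if_splits)
  with Suc show ?case by (simp add: alt_snoc)
qed simp

text \<open>An atom that can be extended by s and by t can be extended by their lcm: the closure
  property that \<open>greatest_exists\<close> asks for.\<close>

lemma atom_alt:
  assumes "atom S m (y @ [s])" "atom S m (y @ [t])" "s \<noteq> t"
  shows "atom S m (y @ alt s t (m s t))"
proof -
  have y: "y \<in> Wd" "s \<in> S" "t \<in> S" using assms by (auto simp: atom_iff)
  have len: "len y = length y" using assms(1) atom_append by (metis atom_iff)
  have "len (y @ [r]) = len y + 1" if "atom S m (y @ [r])" for r
    using that unfolding len by (simp add: atom_iff)
  then have "len (y @ alt s t (m s t)) = len y + m s t"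
    using y assms by (intro len_alt_up) auto
  with y len show ?thesis by (simp add: atom_iff)
qed

text \<open>Left descents of a are right descents of its reversal, whose length
  \<open>len_alt_down\<close> lowers m times in a row.\<close>

lemma atom_two_descents:
  assumes a: "atom S m a" and x: "a \<sim> s # x" "length a = Suc (length x)"
    and y: "a \<sim> t # y" "length a = Suc (length y)" and "s \<noteq> t"
  obtains z where "atom S m (alt s t (m s t) @ z)" "a \<sim> alt s t (m s t) @ z"
proof -
  let ?d = "alt s t (m s t)"
  have A: "a \<in> Wd" "length a = len a" using a by (auto simp: atom_iff)
  then have st: "s \<in> S" "t \<in> S" using cox_in_lists[OF x(1)] cox_in_lists[OF y(1)] by auto
  have down: "len (rev a) = len (rev a @ [r]) + 1"
    if "a \<sim> r # u" "length a = Suc (length u)" "r \<in> S" for r u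
  proof -
    have "rev a @ [r] \<sim> (rev u @ [r]) @ [r]" using cox_rev[OF that(1)] by (intro cox_cong) auto
    then have "rev a @ [r] \<sim> rev u" using cox_trans[OF _ cox_sq[OF that(3), of m "rev u" "[]"]] by simp
    then have "len (rev a @ [r]) \<le> length u" using len_le by fastforce
    then show ?thesis using len_snoc[OF that(3), of "rev a"] that A by (auto simp: len_rev)
  qed
  have "rev a \<in> Wd" using A by (simp add: in_lists_conv_set)
  then have l: "len (rev a) = len (rev a @ ?d) + m s t"
    using down[OF x] down[OF y] st \<open>s \<noteq> t\<close> by (intro len_alt_down) auto
  obtain z where z: "rev a @ ?d \<sim> z" "length z = len (rev a @ ?d)" by (rule len_witness)
  then have "rev a \<sim> z @ rev ?d" using st by (intro cox_move) auto
  then have "rev (rev a) \<sim> rev (z @ rev ?d)" by (rule cox_rev)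
  then have eq: "a \<sim> ?d @ rev z" by simp
  moreover have "length a = length (?d @ rev z)" using A l z by (simp add: len_rev)
  ultimately show ?thesis using that a atom_cong by blast
qed

section \<open>Braid equivalence and Matsumoto's theorem\<close>

lemma br_cox: "u \<approx> v \<Longrightarrow> u \<sim> v"
  by (induction rule: br_eq.induct) (auto intro: cox_sym cox_trans cox_braid)

lemma br_length: "u \<approx> v \<Longrightarrow> length u = length v"
  by (induction rule: br_eq.induct) auto

lemma br_in_lists: "u \<approx> v \<Longrightarrow> u \<in> Wd \<longleftrightarrow> v \<in> Wd"
  using br_cox cox_in_lists by blast

lemma br_context: "u \<approx> v \<Longrightarrow> x @ u @ y \<approx> x @ v @ y"
proof (induction rule: br_eq.induct)
  case (br_braid s t u v)
  then show ?case using br_eq.br_braid[of s S t m "x @ u" "v @ y"] by simp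
qed (auto intro: br_sym br_trans)

lemma br_cong: "u \<approx> u' \<Longrightarrow> v \<approx> v' \<Longrightarrow> u @ v \<approx> u' @ v'"
  using br_context[of u u' "[]" v] br_context[of v v' u' "[]"]
  by (auto intro: br_trans)

lemma br_Cons: "u \<approx> v \<Longrightarrow> s # u \<approx> s # v"
  using br_cong[of "[s]" "[s]" u v] by simp

lemma br_rev: "u \<approx> v \<Longrightarrow> rev u \<approx> rev v"
proof (induction rule: br_eq.induct)
  case (br_braid s t u v)
  then show ?case
    using br_eq.br_braid[of s S t m "rev v" "rev u"] br_eq.br_braid[of t S s m "rev v" "rev u"]
    by (auto simp: rev_alt m_sym[of t s])
qed (auto intro: br_sym br_trans)

lemma br_alt: "s \<in> S \<Longrightarrow> t \<in> S \<Longrightarrow> alt s t (m s t) \<approx> alt t s (m s t)"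
  using br_braid[of s S t m "[]" "[]"] by simp

lemma atom_br: "x \<approx> y \<Longrightarrow> atom S m x \<Longrightarrow> atom S m y"
  using atom_cong br_cox br_length by blast

text \<open>Equal first letters cancel in the Coxeter group, and induction applies. Different first
  letters s and t are both descents, so the element has reduced words beginning with either side of
  the braid relation; one of these shares its first letter with a, the other with b.\<close>

lemma matsumoto:
  assumes "atom S m a" "atom S m b" "a \<sim> b"
  shows "a \<approx> b"
  using assms
proof (induction "length a" arbitrary: a b rule: less_induct)
  case less
  note ab = less.prems
  have l: "length a = length b" using ab len_cong by (auto simp: atom_iff)
  show ?case
  proof (cases a)
    case Nil
    with l show ?thesis by simp
  next
    case (Cons s x)
    with l obtain t y where b: "b = t # y" by (cases b) auto
    have same: "r # u \<approx> r # v"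
      if "r # u \<sim> r # v" "atom S m (r # u)" "atom S m (r # v)" "length u < length a" for r u v
    proof -
      have "r \<in> S" using that by (auto simp: atom_iff)
      then have "u \<sim> v" using cox_left_cancel[of "[r]" u v] that by auto
      moreover have "atom S m u" "atom S m v" using that atom_append[of "[r]"] by auto
      ultimately have "u \<approx> v" using less.hyps that by blast
      then show ?thesis by (rule br_Cons)
    qed
    show ?thesis
    proof (cases "s = t")
      case True
      with same[of s x y] ab Cons b show ?thesis by auto
    next
      case False
      have S: "s \<in> S" "t \<in> S" using ab Cons b by (auto simp: atom_iff)
      obtain z where z: "atom S m (alt s t (m s t) @ z)" "a \<sim> alt s t (m s t) @ z"
        using atom_two_descents[of a s x t y] ab Cons b l False by auto
      obtain n where n: "m s t = Suc n" using m_ge_2[OF S False] by (cases "m s t") auto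
      have br: "alt s t (m s t) @ z \<approx> alt t s (m s t) @ z" using br_cong[OF br_alt[OF S]] by auto
      have "a \<approx> alt s t (m s t) @ z"
        using same[of s x "alt t s n @ z"] z ab(1) Cons n by (simp add: alt_Cons)
      also note br
      also have "alt t s (m s t) @ z \<approx> b"
      proof -
        have "alt t s (m s t) @ z \<sim> b"
          using br_cox[OF br] z(2) ab(3) by (meson cox_sym cox_trans)
        moreover have "length (alt s t n @ z) < length a"
          using z(1,2) ab(1) n len_cong[OF z(2)] by (simp add: atom_iff)
        ultimately show ?thesis
          using same[of t "alt s t n @ z" y] atom_br[OF br z(1)] ab(2) b n by (simp add: alt_Cons)
      qed
      finally show ?thesis .
    qed
  qed
qed

end

section \<open>The Artin monoid\<close>

locale finite_coxeter_system = coxeter +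
  assumes finite_coxeter: "finite_coxeter S m"
begin

text \<open>Divisibility in the monoid. It agrees with \<open>le_pos\<close>, which refers to the
  group, once the monoid is known to embed (\<open>le_pos_iff\<close>).\<close>

definition left_dvd (infix "\<preceq>" 50) where
  "x \<preceq> y \<longleftrightarrow> (\<exists>z\<in>Wd. y \<approx> x @ z)"

lemma left_dvdI: "z \<in> Wd \<Longrightarrow> y \<approx> x @ z \<Longrightarrow> x \<preceq> y"
  by (auto simp: left_dvd_def)

lemma left_dvdE: assumes "x \<preceq> y" obtains z where "z \<in> Wd" "y \<approx> x @ z"
  using assms by (auto simp: left_dvd_def)

lemma left_dvd_append: "z \<in> Wd \<Longrightarrow> x \<preceq> x @ z"
  by (rule left_dvdI) auto

lemma br_left_dvd: "x \<approx> y \<Longrightarrow> x \<preceq> y"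
  using left_dvdI[of "[]" y x] by (auto intro: br_sym)

lemma left_dvd_refl [simp]: "x \<preceq> x"
  by (simp add: br_left_dvd)

lemma left_dvd_trans [trans]: assumes "x \<preceq> y" "y \<preceq> z" shows "x \<preceq> z"
proof -
  from assms obtain u v where u: "u \<in> Wd" "y \<approx> x @ u" and v: "v \<in> Wd" "z \<approx> y @ v"
    by (auto simp: left_dvd_def)
  have "z \<approx> (x @ u) @ v" using v(2) br_cong[OF u(2) br_refl] by (rule br_trans)
  with u v show ?thesis by (intro left_dvdI[of "u @ v"]) auto
qed

lemma left_dvd_br_trans [trans]: "x \<preceq> y \<Longrightarrow> y \<approx> z \<Longrightarrow> x \<preceq> z"
  and br_left_dvd_trans [trans]: "x \<approx> y \<Longrightarrow> y \<preceq> z \<Longrightarrow> x \<preceq> z"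
  using br_left_dvd left_dvd_trans by blast+

lemma left_dvd_length: "x \<preceq> y \<Longrightarrow> length x \<le> length y"
  by (auto elim!: left_dvdE dest: br_length)

lemma left_dvd_length_eq: assumes "x \<preceq> y" "length y \<le> length x" shows "x \<approx> y"
proof -
  from assms(1) obtain z where z: "z \<in> Wd" "y \<approx> x @ z" by (rule left_dvdE)
  with br_length[OF z(2)] assms(2) have "z = []" by simp
  with z show ?thesis by (simp add: br_sym)
qed

lemma left_dvd_antisym: "x \<preceq> y \<Longrightarrow> y \<preceq> x \<Longrightarrow> x \<approx> y"
  using left_dvd_length left_dvd_length_eq by blast

lemma left_dvd_mult: "x \<preceq> y \<Longrightarrow> u @ x \<preceq> u @ y"
  using br_cong[of u u] by (fastforce simp: left_dvd_def)

lemma atom_in_lists: "atom S m x \<Longrightarrow> x \<in> Wd"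
  by (simp add: atom_iff)

lemma atom_Nil [simp]: "atom S m []"
  using len_le[of "[]" "[]"] by (simp add: atom_iff)

lemma atom_left_dvd: "x \<preceq> y \<Longrightarrow> atom S m y \<Longrightarrow> atom S m x"
  by (auto elim!: left_dvdE dest!: atom_br dest: atom_append)

lemma left_dvd_snocE:
  assumes "x @ [s] \<preceq> v" "v \<in> Wd"
  obtains y where "v \<approx> x @ s # y" "s # y \<in> Wd"
proof -
  from assms(1) obtain y where y: "y \<in> Wd" "v \<approx> (x @ [s]) @ y" by (rule left_dvdE)
  with br_in_lists[OF y(2)] assms(2) that show ?thesis by simp
qed

text \<open>Cancel in the Coxeter group, then return to braid equivalence by
  \<open>matsumoto\<close>; this works because all words involved are reduced.\<close>

lemma atom_left_cancel:
  assumes "x @ y \<approx> x @ z" "atom S m (x @ y)"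
  shows "y \<approx> z"
proof -
  have z: "atom S m (x @ z)" using atom_br assms by blast
  have "x \<in> Wd" using assms(2) by (auto dest: atom_in_lists)
  then have "y \<sim> z" using br_cox[OF assms(1)] by (rule cox_left_cancel)
  then show ?thesis
    using matsumoto atom_append(2) assms(2) z by blast
qed

lemma atom_left_dvd_cancel:
  assumes "x @ y \<preceq> x @ z" "atom S m (x @ z)"
  shows "y \<preceq> z"
proof -
  from assms(1) obtain w where w: "w \<in> Wd" "x @ z \<approx> (x @ y) @ w" by (rule left_dvdE)
  then have "z \<approx> y @ w" using atom_left_cancel[of x z "y @ w"] assms(2) by simp
  with w(1) show ?thesis by (rule left_dvdI)
qed

lemma atom_lcm:
  assumes a: "atom S m a" and s: "[s] \<preceq> a" and t: "[t] \<preceq> a" and "s \<noteq> t"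
  shows "alt s t (m s t) \<preceq> a"
proof -
  from s t obtain x y where x: "a \<approx> s # x" and y: "a \<approx> t # y"
    by (auto elim!: left_dvdE)
  obtain z where z: "atom S m (alt s t (m s t) @ z)" "a \<sim> alt s t (m s t) @ z"
    using atom_two_descents[OF a br_cox[OF x] _ br_cox[OF y] _ \<open>s \<noteq> t\<close>] br_length[OF x] br_length[OF y]
    by auto
  have "a \<approx> alt s t (m s t) @ z" using matsumoto[OF a z] .
  then show ?thesis using z(1) by (intro left_dvdI[of z]) (auto dest: atom_in_lists)
qed

text \<open>If two maximal elements x and y of X have a common prefix z that is extended by s and t
  respectively, a maximal element above the lcm has longer common prefixes with both x and y.\<close>
lemma greatest_exists:
  assumes bound: "\<And>x. x \<in> X \<Longrightarrow> length x \<le> N"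
    and lists: "X \<subseteq> Wd"
    and closed: "\<And>x y. x \<in> X \<Longrightarrow> y \<preceq> x \<Longrightarrow> y \<in> X"
    and "[] \<in> X"
    and lcm: "\<And>x s t. x @ [s] \<in> X \<Longrightarrow> x @ [t] \<in> X \<Longrightarrow> s \<noteq> t \<Longrightarrow> x @ alt s t (m s t) \<in> X"
  obtains q where "q \<in> X" "\<And>x. x \<in> X \<Longrightarrow> x \<preceq> q"
proof -
  define maximal where "maximal q \<longleftrightarrow> q \<in> X \<and> (\<forall>x\<in>X. q \<preceq> x \<longrightarrow> x \<preceq> q)" for q
  have above: "\<exists>q. maximal q \<and> x \<preceq> q" if x: "x \<in> X" for x
  proof -
    have "\<exists>q. (q \<in> X \<and> x \<preceq> q) \<and> (\<forall>y. y \<in> X \<and> x \<preceq> y \<longrightarrow> length y \<le> length q)"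
      by (rule ex_has_greatest_nat[where k = x and b = "Suc N"]) (auto simp: x bound le_imp_less_Suc)
    then obtain q where q: "q \<in> X" "x \<preceq> q" "\<And>y. y \<in> X \<Longrightarrow> x \<preceq> y \<Longrightarrow> length y \<le> length q"
      by blast
    have "y \<preceq> q" if "y \<in> X" "q \<preceq> y" for y
      using that q(3)[of y] left_dvd_trans[OF q(2)] left_dvd_length_eq[of q y]
      by (blast intro: br_left_dvd br_sym)
    with q show ?thesis by (auto simp: maximal_def)
  qed
  have unique: "x \<approx> y" if "maximal x" "maximal y" "z \<preceq> x" "z \<preceq> y" for x y z
    using that
  proof (induction "N - length z" arbitrary: x y z rule: less_induct)
    case less
    note xy = less.prems
    have X: "x \<in> X" "y \<in> X" using xy by (auto simp: maximal_def)
    obtain a b where a: "a \<in> Wd" "x \<approx> z @ a" and b: "b \<in> Wd" "y \<approx> z @ b"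
      using xy by (auto elim!: left_dvdE)
    have step: "u \<approx> v" if "maximal u" "maximal v" "z @ [r] \<preceq> u" "z @ [r] \<preceq> v" for u v r
    proof -
      have "length (z @ [r]) \<le> N"
        using left_dvd_length[OF that(3)] bound[of u] that(1) by (auto simp: maximal_def)
      then have "N - length (z @ [r]) < N - length z" by simp
      then show ?thesis using less.hyps that by blast
    qed
    show ?case
    proof (cases "a = [] \<or> b = []")
      case True
      then have "x \<preceq> y \<or> y \<preceq> x" using a b xy br_left_dvd_trans by auto
      then show ?thesis using xy X by (auto simp: maximal_def intro: left_dvd_antisym)
    next
      case False
      then obtain s a' t b' where ab: "a = s # a'" "b = t # b'" by (meson list.exhaust)
      have s: "z @ [s] \<preceq> x" and t: "z @ [t] \<preceq> y"
        using a b ab left_dvdI[of a' x "z @ [s]"] left_dvdI[of b' y "z @ [t]"] by auto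
      show ?thesis
      proof (cases "s = t")
        case True
        with s t step xy show ?thesis by blast
      next
        case st: False
        have S: "s \<in> S" "t \<in> S" using a b ab by auto
        obtain n where n: "m s t = Suc n" using m_ge_2[OF S st] by (cases "m s t") auto
        have "z @ alt s t (m s t) \<in> X"
          using lcm[OF closed[OF X(1) s] closed[OF X(2) t] st] .
        then obtain q where q: "maximal q" "z @ alt s t (m s t) \<preceq> q" using above by blast
        have "z @ [s] \<preceq> z @ alt s t (m s t)" "z @ [t] \<preceq> z @ alt t s (m s t)"
          using S n left_dvd_append[of "alt t s n" "z @ [s]"] left_dvd_append[of "alt s t n" "z @ [t]"]
          by (auto simp: alt_Cons)
        moreover have "z @ alt t s (m s t) \<approx> z @ alt s t (m s t)"
          using br_cong[OF br_refl br_sym[OF br_alt[OF S]]] .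
        ultimately have "z @ [s] \<preceq> q" "z @ [t] \<preceq> q"
          using q(2) left_dvd_trans left_dvd_br_trans by blast+
        then have "x \<approx> q" "y \<approx> q" using step s t xy q(1) by blast+
        then show ?thesis using br_trans br_sym by blast
      qed
    qed
  qed
  obtain q where q: "maximal q" using above[OF \<open>[] \<in> X\<close>] by blast
  have Nil: "[] \<preceq> x" if "x \<in> X" for x using that lists by (intro left_dvdI[of x]) auto
  have "x \<preceq> q" if "x \<in> X" for x
  proof -
    from above[OF that] obtain q' where q': "maximal q'" "x \<preceq> q'" by blast
    moreover from q q' have "q' \<approx> q" using unique[of q' q "[]"] Nil by (auto simp: maximal_def)
    ultimately show ?thesis using left_dvd_br_trans by blast
  qed
  with q that show ?thesis by (auto simp: maximal_def)
qed

section \<open>Bounded length and the greatest atom \<Delta>\<close>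

lemma len_bounded: obtains N where "\<And>w. w \<in> Wd \<Longrightarrow> len w \<le> N"
proof -
  define cl where "cl w = {w'. set w' \<subseteq> S \<and> w \<sim> w'}" for w
  \<comment> \<open>\<open>len\<close> is constant on each of the finitely many classes; the choice
    takes a representative of the class.\<close>
  have "len w \<in> (\<lambda>C. len (SOME w. w \<in> C)) ` {cl w | w. set w \<subseteq> S}" if "w \<in> Wd" for w
  proof -
    have "w \<in> cl w" using that by (auto simp: cl_def)
    then have "(SOME w'. w' \<in> cl w) \<in> cl w" by (rule someI)
    then have "len w = len (SOME w'. w' \<in> cl w)" by (intro len_cong) (simp add: cl_def)
    with that show ?thesis by auto
  qed
  moreover have "finite {cl w | w. set w \<subseteq> S}"
    using finite_coxeter by (simp add: finite_coxeter_def cl_def)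
  ultimately have "finite (len ` Wd)"
    by (meson finite_imageI finite_subset image_subsetI)
  then show ?thesis using that[of "Max (len ` Wd)"] by auto
qed

lemma atom_bounded: obtains N where "\<And>x. atom S m x \<Longrightarrow> length x \<le> N"
  using len_bounded by (metis atom_iff)

abbreviation "\<Delta> \<equiv> Delta S m"

text \<open>\<open>Delta\<close> is chosen by maximal length only. It divides the greatest atom q
  and is at least as long, so the two are braid equivalent.\<close>

lemma atom_Delta [simp]: "atom S m \<Delta>"
  and atom_le_Delta: "atom S m x \<Longrightarrow> x \<preceq> \<Delta>"
proof -
  obtain N where N: "\<And>x. atom S m x \<Longrightarrow> length x \<le> N" using atom_bounded by blast
  obtain q where q: "q \<in> Collect (atom S m)" "\<And>x. x \<in> Collect (atom S m) \<Longrightarrow> x \<preceq> q"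
    by (rule greatest_exists[of "Collect (atom S m)" N])
      (auto intro: N atom_left_dvd atom_alt dest: atom_in_lists)
  have max: "len w \<le> length q" if w: "set w \<subseteq> S" for w
  proof -
    have "w \<in> Wd" using w by auto
    then obtain x where "atom S m x" "w \<sim> x" by (rule atom_witness)
    then show ?thesis using left_dvd_length[OF q(2)[of x]] len_cong by (simp add: atom_iff)
  qed
  then have "atom S m q \<and> (\<forall>w. set w \<subseteq> S \<longrightarrow> len w \<le> len q)"
    using q(1) by (simp add: atom_iff)
  then have D: "atom S m \<Delta> \<and> (\<forall>w. set w \<subseteq> S \<longrightarrow> len w \<le> len \<Delta>)"
    unfolding Delta_def by (rule someI)
  then show "atom S m \<Delta>" by simp
  have "length q \<le> length \<Delta>" using D q(1) by (auto simp: atom_iff)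
  then have "\<Delta> \<approx> q" using D q(2) left_dvd_length_eq by simp
  then show "x \<preceq> \<Delta>" if "atom S m x"
    using q(2) that left_dvd_br_trans br_sym by blast
qed

lemma Delta_in_lists [simp]: "\<Delta> \<in> Wd"
  by (simp add: atom_in_lists)

lemma atom_iff_le_Delta: "atom S m x \<longleftrightarrow> x \<preceq> \<Delta>"
  using atom_le_Delta atom_left_dvd by auto

section \<open>The greatest atom dividing a product\<close>

definition is_ext where
  "is_ext u v t \<longleftrightarrow> atom S m (u @ t) \<and> t \<preceq> v \<and> (\<forall>t'. atom S m (u @ t') \<and> t' \<preceq> v \<longrightarrow> t' \<preceq> t)"

text \<open>For atoms u and v this is \<alpha>(u v) with the factor u removed; see
  \<open>al_om_append\<close>.\<close>

definition ext where "ext u v = (SOME t. is_ext u v t)"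

definition quo where "quo t v = (SOME z. z \<in> Wd \<and> v \<approx> t @ z)"

lemma is_ext_ext: assumes u: "atom S m u" and v: "atom S m v" shows "is_ext u v (ext u v)"
proof -
  let ?X = "{t. atom S m (u @ t) \<and> t \<preceq> v}"
  obtain q where "q \<in> ?X" "\<And>x. x \<in> ?X \<Longrightarrow> x \<preceq> q"
  proof (rule greatest_exists[of ?X "length v"])
    show "y \<in> ?X" if "x \<in> ?X" "y \<preceq> x" for x y
      using that left_dvd_mult[of y x u] left_dvd_trans atom_left_dvd by blast
    show "x @ alt s t (m s t) \<in> ?X" if st: "x @ [s] \<in> ?X" "x @ [t] \<in> ?X" "s \<noteq> t" for x s t
    proof -
      have "atom S m (u @ x @ alt s t (m s t))" using that atom_alt[of "u @ x" s t] by simp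
      \<comment> \<open>v is an atom, so x can be cancelled from it, and the lcm of the two next
        letters divides what is left.\<close>
      moreover have "x @ alt s t (m s t) \<preceq> v"
      proof -
        obtain y z where y: "v \<approx> x @ s # y" and z: "v \<approx> x @ t # z" and yz: "s # y \<in> Wd" "t # z \<in> Wd"
          using st left_dvd_snocE[OF _ atom_in_lists[OF v]] by (metis mem_Collect_eq)
        have a: "atom S m (x @ s # y)" using v y atom_br by blast
        have "x @ s # y \<approx> x @ t # z" using y z br_sym br_trans by blast
        then have "s # y \<approx> t # z" using a atom_left_cancel by blast
        then have "alt s t (m s t) \<preceq> s # y"
          using atom_append(2)[OF a] yz \<open>s \<noteq> t\<close> by (intro atom_lcm) (auto intro: left_dvdI[of y] left_dvdI[of z])
        then have "x @ alt s t (m s t) \<preceq> x @ s # y" by (rule left_dvd_mult)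
        then show ?thesis using y br_sym left_dvd_br_trans by blast
      qed
      ultimately show ?thesis by simp
    qed
    show "[] \<in> ?X" using u v by (auto intro!: left_dvdI[of v] dest: atom_in_lists)
  qed (auto dest: left_dvd_length atom_in_lists)
  then have "is_ext u v q" by (auto simp: is_ext_def)
  then show ?thesis unfolding ext_def by (rule someI)
qed

lemma atom_ext: "atom S m u \<Longrightarrow> atom S m v \<Longrightarrow> atom S m (u @ ext u v)"
  and ext_dvd: "atom S m u \<Longrightarrow> atom S m v \<Longrightarrow> ext u v \<preceq> v"
  and ext_greatest: "atom S m u \<Longrightarrow> atom S m v \<Longrightarrow> atom S m (u @ t) \<Longrightarrow> t \<preceq> v \<Longrightarrow> t \<preceq> ext u v"
  using is_ext_ext[of u v] by (auto simp: is_ext_def)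

lemma quo: "t \<preceq> v \<Longrightarrow> quo t v \<in> Wd" "t \<preceq> v \<Longrightarrow> v \<approx> t @ quo t v"
  using someI_ex[of "\<lambda>z. z \<in> Wd \<and> v \<approx> t @ z"] unfolding left_dvd_def quo_def by blast+

text \<open>The choice sees u and v only through a predicate invariant under braid equivalence, so
  even the chosen words coincide. This carries \<open>al\<close> and \<open>om\<close> through a
  common prefix by rewriting.\<close>

lemma ext_cong: assumes "u \<approx> u'" "v \<approx> v'" shows "ext u v = ext u' v'"
proof -
  have "atom S m (u @ t) \<longleftrightarrow> atom S m (u' @ t)" for t
    using br_cong[OF assms(1) br_refl, of t] atom_br br_sym by blast
  moreover have "t \<preceq> v \<longleftrightarrow> t \<preceq> v'" for t
    using assms(2) left_dvd_br_trans br_sym by blast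
  ultimately show ?thesis unfolding ext_def is_ext_def by simp
qed

lemma quo_cong: assumes "v \<approx> v'" shows "quo t v = quo t v'"
proof -
  have "v \<approx> t @ z \<longleftrightarrow> v' \<approx> t @ z" for z
    using assms br_trans br_sym by blast
  then show ?thesis unfolding quo_def by simp
qed

text \<open>The paper's \<open>\<alpha>\<close>, computed letter by letter from the right, and the remaining factor.\<close>
primrec al :: "'a list \<Rightarrow> 'a list" where
  "al [] = []"
| "al (s # w) = s # ext [s] (al w)"

primrec om :: "'a list \<Rightarrow> 'a list" where
  "om [] = []"
| "om (s # w) = quo (ext [s] (al w)) (al w) @ om w"

lemma atom_letter: "s \<in> S \<Longrightarrow> atom S m [s]"
  using len_even[of "[s]"] len_le[of "[s]" "[s]"] by (auto simp: atom_iff le_Suc_eq)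

lemma atom_al [simp]: "w \<in> Wd \<Longrightarrow> atom S m (al w)"
proof (induction w)
  case (Cons s w)
  then show ?case using atom_ext[of "[s]" "al w"] atom_letter by simp
qed simp

lemma al_in_lists [simp]: "w \<in> Wd \<Longrightarrow> al w \<in> Wd"
  by (rule atom_in_lists) simp

lemma om_in_lists [simp]: "w \<in> Wd \<Longrightarrow> om w \<in> Wd"
proof (induction w)
  case (Cons s w)
  then show ?case using quo(1)[OF ext_dvd[of "[s]" "al w"]] atom_letter by simp
qed simp

lemma al_om: "w \<in> Wd \<Longrightarrow> w \<approx> al w @ om w"
proof (induction w)
  case (Cons s w)
  let ?t = "ext [s] (al w)"
  have "al w \<approx> ?t @ quo ?t (al w)" using Cons atom_letter by (intro quo(2) ext_dvd) auto
  then have "al w @ om w \<approx> (?t @ quo ?t (al w)) @ om w" by (rule br_cong) simp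
  then have "w \<approx> ?t @ quo ?t (al w) @ om w" using Cons br_trans by fastforce
  then show ?case by (simp add: br_Cons)
qed simp

text \<open>Prepending the letters of an atom u one by one agrees, up to braid equivalence, with
  extending u in one step. So only the class of u matters, which gives invariance under braid
  relations, since both sides of such a relation are atoms.\<close>

lemma al_om_append:
  assumes w: "w \<in> Wd" and u: "atom S m u"
  shows "al (u @ w) \<approx> u @ ext u (al w) \<and> om (u @ w) \<approx> quo (ext u (al w)) (al w) @ om w"
  using u
proof (induction u)
  case Nil
  have a: "atom S m (al w)" using w by simp
  have e: "al w \<preceq> ext [] (al w)" using a by (intro ext_greatest) auto
  then have 1: "ext [] (al w) \<approx> al w" using a ext_dvd[of "[]" "al w"] left_dvd_antisym by simp
  have "quo (ext [] (al w)) (al w) = []"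
    using quo(2)[OF ext_dvd[of "[]" "al w"]] a br_length left_dvd_length[OF e] by fastforce
  with 1 show ?case by (auto intro: br_sym)
next
  case (Cons s u)
  let ?v = "al w"
  let ?r = "ext u ?v" and ?t = "ext (s # u) ?v" and ?e = "ext [s] (al (u @ w))"
  have v: "atom S m ?v" using w by simp
  have u: "atom S m u" using Cons.prems atom_append(2)[of "[s]" u] by simp
  have s: "atom S m [s]" using Cons.prems atom_append(1)[of "[s]" u] by simp
  have IH: "al (u @ w) \<approx> u @ ?r" "om (u @ w) \<approx> quo ?r ?v @ om w" using Cons.IH[OF u] by auto
  have ur: "atom S m (u @ ?r)" using atom_ext[OF u v] .
  have t: "atom S m ((s # u) @ ?t)" "?t \<preceq> ?v" using atom_ext[OF Cons.prems v] ext_dvd[OF Cons.prems v] by auto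
  have t0: "?e = ext [s] (u @ ?r)" using IH(1) by (intro ext_cong) auto
  have tr: "?t \<preceq> ?r" using t atom_append(2)[of "[s]" "u @ ?t"] by (intro ext_greatest[OF u v]) auto
  \<comment> \<open>\<open>?e\<close> begins with u, and what follows is an extension of s u inside
    v, hence divides the greatest one, \<open>?t\<close>.\<close>
  have eq: "?e \<approx> u @ ?t"
  proof (rule left_dvd_antisym)
    show "u @ ?t \<preceq> ?e"
      unfolding t0 using t tr by (intro ext_greatest[OF s ur] left_dvd_mult) auto
    have "u \<preceq> ?e" unfolding t0 using Cons.prems ur
      by (intro ext_greatest[OF s ur] left_dvd_append) (auto dest: atom_in_lists)
    then obtain x where x: "x \<in> Wd" "?e \<approx> u @ x" by (rule left_dvdE)
    have "atom S m ([s] @ ?e)" unfolding t0 by (rule atom_ext[OF s ur])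
    moreover have "[s] @ ?e \<approx> s # u @ x" using br_Cons[OF x(2)] by simp
    ultimately have sux: "atom S m ((s # u) @ x)" using atom_br by fastforce
    have "u @ x \<preceq> u @ ?r" using br_left_dvd_trans[OF br_sym[OF x(2)]] ext_dvd[OF s ur] t0 by simp
    then have "x \<preceq> ?r" using ur by (rule atom_left_dvd_cancel)
    then have "x \<preceq> ?v" using ext_dvd[OF u v] left_dvd_trans by blast
    then have "x \<preceq> ?t" using sux by (intro ext_greatest[OF Cons.prems v])
    then have "u @ x \<preceq> u @ ?t" by (rule left_dvd_mult)
    then show "?e \<preceq> u @ ?t" using x(2) br_left_dvd_trans by blast
  qed
  have "om ((s # u) @ w) \<approx> quo ?t ?v @ om w"
  proof -
    let ?q1 = "quo ?e (al (u @ w))" and ?q2 = "quo ?r ?v"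
    have q1: "al (u @ w) \<approx> ?e @ ?q1"
      unfolding t0 by (rule quo(2)) (metis IH(1) br_sym ext_dvd left_dvd_br_trans s ur)
    have "u @ ?r \<approx> al (u @ w)" using IH(1) by (rule br_sym)
    also note q1
    also have "?e @ ?q1 \<approx> (u @ ?t) @ ?q1" using eq by (rule br_cong) simp
    finally have "u @ ?r \<approx> u @ ?t @ ?q1" by simp
    then have r: "?r \<approx> ?t @ ?q1" using ur by (rule atom_left_cancel)
    have "?t @ quo ?t ?v \<approx> ?v" using quo(2)[OF t(2)] by (rule br_sym)
    also have "?v \<approx> ?r @ ?q2" using quo(2)[OF ext_dvd[OF u v]] .
    also have "?r @ ?q2 \<approx> (?t @ ?q1) @ ?q2" using r by (rule br_cong) simp
    finally have "?t @ quo ?t ?v \<approx> ?t @ ?q1 @ ?q2" by simp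
    then have q: "quo ?t ?v \<approx> ?q1 @ ?q2"
      using atom_br[OF quo(2)[OF t(2)] v] by (rule atom_left_cancel)
    have "om ((s # u) @ w) = ?q1 @ om (u @ w)" by simp
    also have "\<dots> \<approx> ?q1 @ ?q2 @ om w" using IH(2) by (intro br_cong) auto
    also have "\<dots> \<approx> quo ?t ?v @ om w" using br_cong[OF br_sym[OF q] br_refl, of "om w"] by simp
    finally show ?thesis .
  qed
  then show ?case using br_Cons[OF eq] by simp
qed

lemma al_om_br:
  assumes "u \<approx> v" "u \<in> Wd"
  shows "al u \<approx> al v \<and> om u \<approx> om v"
  using assms
proof (induction rule: br_eq.induct)
  case (br_braid s t x y)
  let ?a = "alt s t (m s t)" and ?b = "alt t s (m s t)"
  have y: "y \<in> Wd" using br_braid by auto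
  have a: "atom S m ?a"
  proof (cases "s = t")
    case True
    then show ?thesis using br_braid m_self atom_letter by (simp add: alt_same)
  next
    case False
    then show ?thesis using atom_alt[of "[]" s t] br_braid atom_letter by simp
  qed
  have ab: "?a \<approx> ?b" using br_alt br_braid by simp
  have b: "atom S m ?b" using atom_br[OF ab a] .
  have e: "ext ?a (al y) = ext ?b (al y)" using ab by (intro ext_cong) auto
  have "al (x @ ?a @ y) \<approx> al (x @ ?b @ y) \<and> om (x @ ?a @ y) \<approx> om (x @ ?b @ y)"
  proof (induction x)
    case Nil
    have "al (?a @ y) \<approx> ?a @ ext ?b (al y)" using al_om_append[OF y a] e by simp
    also have "\<dots> \<approx> ?b @ ext ?b (al y)" using ab by (rule br_cong) simp
    also have "\<dots> \<approx> al (?b @ y)" using al_om_append[OF y b] br_sym by blast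
    finally show ?case using al_om_append[OF y a] al_om_append[OF y b] e br_sym br_trans by fastforce
  next
    case (Cons r x)
    then have "ext [r] (al (x @ ?a @ y)) = ext [r] (al (x @ ?b @ y))" by (intro ext_cong) auto
    moreover have "quo z (al (x @ ?a @ y)) = quo z (al (x @ ?b @ y))" for z
      using Cons by (intro quo_cong) auto
    ultimately show ?case using Cons by (simp add: br_cong)
  qed
  then show ?case .
next
  case (br_sym u w)
  then show ?case using br_in_lists br_eq.br_sym by blast
next
  case (br_trans u v w)
  then show ?case using br_in_lists br_eq.br_trans by blast
qed auto

lemma al_br: "u \<approx> v \<Longrightarrow> u \<in> Wd \<Longrightarrow> al u \<approx> al v"
  and om_br: "u \<approx> v \<Longrightarrow> u \<in> Wd \<Longrightarrow> om u \<approx> om v"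
  using al_om_br by auto

lemma al_dvd: "w \<in> Wd \<Longrightarrow> al w \<preceq> w"
  using al_om by (intro left_dvdI[of "om w"]) auto

lemma al_greatest: assumes w: "w \<in> Wd" and a: "atom S m a" "a \<preceq> w" shows "a \<preceq> al w"
proof -
  from a(2) obtain z where z: "z \<in> Wd" "w \<approx> a @ z" by (rule left_dvdE)
  have "a \<preceq> a @ ext a (al z)"
    using z a atom_ext[of a "al z"] by (intro left_dvd_append) (auto dest: atom_in_lists)
  also have "a @ ext a (al z) \<approx> al (a @ z)" using al_om_append[OF z(1) a(1)] br_sym by blast
  also have "al (a @ z) \<approx> al w" using al_br[OF z(2) w] by (rule br_sym)
  finally show ?thesis .
qed

lemma al_atom: assumes "atom S m a" shows "al a \<approx> a"
  using assms al_dvd[of a] al_greatest[of a a] atom_in_lists[OF assms] by (intro left_dvd_antisym) auto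

text \<open>Taking \<alpha>(y) for z gives the identity \<alpha>(x y) = \<alpha>(x
  \<alpha>(y)).\<close>

lemma al_append_cong: "al y \<approx> al z \<Longrightarrow> al (x @ y) \<approx> al (x @ z)"
proof (induction x)
  case (Cons s x)
  then have "ext [s] (al (x @ y)) = ext [s] (al (x @ z))" by (intro ext_cong) auto
  then show ?case by simp
qed simp

lemma Delta_dvd_iff_al: assumes w: "w \<in> Wd" shows "\<Delta> \<preceq> w \<longleftrightarrow> \<Delta> \<preceq> al w"
  using al_greatest[OF w] al_dvd[OF w] left_dvd_trans by auto

lemma Delta_dvd_append_al:
  assumes "x \<in> Wd" "y \<in> Wd" shows "\<Delta> \<preceq> x @ y \<longleftrightarrow> \<Delta> \<preceq> x @ al y"
proof -
  have "al (x @ y) \<approx> al (x @ al y)"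
    using al_append_cong br_sym[OF al_atom[OF atom_al]] assms by blast
  then have "\<Delta> \<preceq> al (x @ y) \<longleftrightarrow> \<Delta> \<preceq> al (x @ al y)"
    using left_dvd_br_trans br_sym by blast
  then show ?thesis
    using Delta_dvd_iff_al[of "x @ y"] Delta_dvd_iff_al[of "x @ al y"] assms by auto
qed

text \<open>No nonempty word extends \<Delta> to an atom, so \<open>om\<close> strips exactly
  \<Delta>. As \<open>om\<close> respects braid equivalence, left cancellation of \<Delta>
  follows.\<close>

lemma om_Delta: assumes z: "z \<in> Wd" shows "om (\<Delta> @ z) \<approx> z"
proof -
  let ?t = "ext \<Delta> (al z)"
  have "\<Delta> @ ?t \<preceq> \<Delta>" using z by (intro atom_le_Delta atom_ext) auto
  then have t: "?t = []" using left_dvd_length by fastforce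
  have "quo [] (al z) \<approx> al z"
    using br_sym[OF quo(2)[of "[]" "al z"]] z left_dvdI[of "al z" "al z" "[]"] by auto
  then have "quo [] (al z) @ om z \<approx> al z @ om z" by (rule br_cong) simp
  then show ?thesis
    using al_om_append[OF z atom_Delta] al_om[OF z] t br_trans br_sym by metis
qed

lemma Delta_left_cancel:
  assumes "\<Delta> @ x \<approx> \<Delta> @ y" "x \<in> Wd"
  shows "x \<approx> y"
proof -
  have "y \<in> Wd" using br_in_lists[OF assms(1)] assms(2) by simp
  moreover have "om (\<Delta> @ x) \<approx> om (\<Delta> @ y)" using assms by (intro om_br) auto
  ultimately show ?thesis using om_Delta assms(2) br_trans br_sym by metis
qed

section \<open>Complements, conjugation by \<Delta> and cancellation\<close>

lemma atom_rev: "atom S m (rev x) \<longleftrightarrow> atom S m x"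
  by (simp add: atom_def len_rev)

lemma rev_Delta: "rev \<Delta> \<approx> \<Delta>"
  by (rule left_dvd_length_eq) (simp_all add: atom_le_Delta atom_rev)

text \<open>The complement of s in \<Delta>, together with a letter that completes it to \<Delta> on
  the other side. With \<open>tau s\<close> for that letter, s \<Delta> = s \<open>co s\<close>
  \<open>tau s\<close> = \<Delta> \<open>tau s\<close>, so \<open>tau\<close> is conjugation by
  \<Delta>.\<close>

definition co where
  "co s = (SOME d. d \<in> Wd \<and> s # d \<approx> \<Delta> \<and> (\<exists>t\<in>S. d @ [t] \<approx> \<Delta>))"

definition tau where
  "tau s = (SOME t. t \<in> S \<and> co s @ [t] \<approx> \<Delta>)"

lemma co_tau:
  assumes "s \<in> S"
  shows co_in_lists: "co s \<in> Wd" and letter_co: "s # co s \<approx> \<Delta>"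
    and tau_in: "tau s \<in> S" and co_letter: "co s @ [tau s] \<approx> \<Delta>"
proof -
  obtain d where d: "d \<in> Wd" "\<Delta> \<approx> [s] @ d"
    by (rule left_dvdE[OF atom_le_Delta[OF atom_letter[OF assms]]])
  then have "atom S m d" using atom_br[OF d(2)] atom_append(2)[of "[s]" d] by simp
  then obtain z where z: "z \<in> Wd" "\<Delta> \<approx> d @ z" using left_dvdE[OF atom_le_Delta] by blast
  have "length z = 1" using br_length[OF d(2)] br_length[OF z(2)] by simp
  then obtain t where "z = [t]" by (auto simp: length_Suc_conv)
  with d z have "\<exists>d. d \<in> Wd \<and> s # d \<approx> \<Delta> \<and> (\<exists>t\<in>S. d @ [t] \<approx> \<Delta>)"
    using br_sym by fastforce
  then have *: "co s \<in> Wd \<and> s # co s \<approx> \<Delta> \<and> (\<exists>t\<in>S. co s @ [t] \<approx> \<Delta>)"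
    unfolding co_def by (rule someI_ex)
  then show "co s \<in> Wd" "s # co s \<approx> \<Delta>" by auto
  from * have "\<exists>t. t \<in> S \<and> co s @ [t] \<approx> \<Delta>" by blast
  then have "tau s \<in> S \<and> co s @ [tau s] \<approx> \<Delta>"
    unfolding tau_def by (rule someI_ex)
  then show "tau s \<in> S" "co s @ [tau s] \<approx> \<Delta>" by auto
qed

lemma map_tau_in_lists [simp]: "x \<in> Wd \<Longrightarrow> map tau x \<in> Wd"
  by (induction x) (auto simp: tau_in)

lemma letter_Delta: assumes "s \<in> S" shows "[s] @ \<Delta> \<approx> \<Delta> @ [tau s]"
proof -
  have "[s] @ \<Delta> \<approx> [s] @ co s @ [tau s]" using br_sym[OF co_letter[OF assms]] by (intro br_cong) auto
  also have "\<dots> \<approx> \<Delta> @ [tau s]" using br_cong[OF letter_co[OF assms] br_refl, of "[tau s]"] by simp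
  finally show ?thesis .
qed

text \<open>Reverse \<open>letter_Delta\<close>, using that \<Delta> is its own reversal. The two
  relations together make \<open>tau\<close> an involution.\<close>

lemma Delta_letter: assumes "s \<in> S" shows "\<Delta> @ [s] \<approx> [tau s] @ \<Delta>"
proof -
  have "\<Delta> @ [s] \<approx> rev \<Delta> @ [s]" using br_sym[OF rev_Delta] by (rule br_cong) simp
  also have "\<dots> \<approx> [tau s] @ rev \<Delta>" using br_rev[OF letter_Delta[OF assms]] by simp
  also have "\<dots> \<approx> [tau s] @ \<Delta>" using rev_Delta by (intro br_cong) auto
  finally show ?thesis .
qed

lemma word_Delta: "x \<in> Wd \<Longrightarrow> x @ \<Delta> \<approx> \<Delta> @ map tau x"
proof (induction x)
  case (Cons s x)
  have "(s # x) @ \<Delta> \<approx> [s] @ \<Delta> @ map tau x" using Cons by (simp add: br_Cons)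
  also have "\<dots> \<approx> \<Delta> @ [tau s] @ map tau x"
    using br_cong[OF letter_Delta br_refl, of s "map tau x"] Cons by simp
  finally show ?case by simp
qed simp

lemma Delta_word: "x \<in> Wd \<Longrightarrow> \<Delta> @ x \<approx> map tau x @ \<Delta>"
proof (induction x rule: rev_induct)
  case (snoc s x)
  have "\<Delta> @ x @ [s] \<approx> map tau x @ \<Delta> @ [s]"
    using br_cong[OF snoc.IH br_refl, of "[s]"] snoc by simp
  also have "\<dots> \<approx> map tau x @ [tau s] @ \<Delta>"
    using snoc by (intro br_cong Delta_letter) auto
  finally show ?case by simp
qed simp

lemma tau_br: assumes "x \<approx> y" "x \<in> Wd" shows "map tau x \<approx> map tau y"
proof (rule Delta_left_cancel)
  have y: "y \<in> Wd" using assms br_in_lists by blast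
  have "\<Delta> @ map tau x \<approx> x @ \<Delta>" using word_Delta[OF assms(2)] by (rule br_sym)
  also have "\<dots> \<approx> y @ \<Delta>" using assms(1) by (rule br_cong) simp
  also have "\<dots> \<approx> \<Delta> @ map tau y" using y by (rule word_Delta)
  finally show "\<Delta> @ map tau x \<approx> \<Delta> @ map tau y" .
qed (use assms in simp)

lemma tau_tau: assumes "x \<in> Wd" shows "map tau (map tau x) \<approx> x"
proof (rule Delta_left_cancel)
  have "\<Delta> @ map tau (map tau x) \<approx> map tau x @ \<Delta>"
    using br_sym[OF word_Delta[OF map_tau_in_lists[OF assms]]] .
  also have "\<dots> \<approx> \<Delta> @ x" using Delta_word[OF assms] by (rule br_sym)
  finally show "\<Delta> @ map tau (map tau x) \<approx> \<Delta> @ x" .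
qed (use assms in \<open>simp del: map_map\<close>)

lemma tau_Delta: "map tau \<Delta> \<approx> \<Delta>"
  using Delta_left_cancel[OF br_sym[OF word_Delta]] by simp

lemma tau_left_dvd: assumes "x \<preceq> y" "y \<in> Wd" shows "map tau x \<preceq> map tau y"
proof -
  obtain z where z: "z \<in> Wd" "y \<approx> x @ z" using assms(1) by (rule left_dvdE)
  have "map tau y \<approx> map tau x @ map tau z" using tau_br[OF z(2) assms(2)] by simp
  with z(1) show ?thesis by (intro left_dvdI[of "map tau z"]) auto
qed

lemma atom_tau: "atom S m x \<Longrightarrow> atom S m (map tau x)"
  using tau_left_dvd[of x \<Delta>] left_dvd_br_trans[OF _ tau_Delta] atom_iff_le_Delta by simp

lemma Delta_dvd_tau: assumes "x \<in> Wd" shows "\<Delta> \<preceq> map tau x \<longleftrightarrow> \<Delta> \<preceq> x"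
proof -
  have "\<Delta> \<preceq> map tau y" if "\<Delta> \<preceq> y" "y \<in> Wd" for y
    using tau_left_dvd[OF that] br_left_dvd_trans[OF br_sym[OF tau_Delta]] by blast
  from this[of x] this[of "map tau x"] show ?thesis
    using left_dvd_br_trans[OF _ tau_tau[OF assms]] assms map_tau_in_lists by blast
qed

text \<open>Multiply on the left by a word that completes the first letter to \<Delta>, and cancel
  \<Delta>.\<close>

lemma left_cancel: "u @ x \<approx> u @ y \<Longrightarrow> u \<in> Wd \<Longrightarrow> x \<in> Wd \<Longrightarrow> x \<approx> y"
proof (induction u)
  case (Cons s u)
  let ?e = "rev (co s)"
  have s: "s \<in> S" using Cons by simp
  have "?e @ [s] \<approx> rev \<Delta>" using br_rev[OF letter_co[OF s]] by simp
  then have e: "?e @ [s] \<approx> \<Delta>" using rev_Delta by (rule br_trans)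
  have "\<Delta> @ u @ x \<approx> (?e @ [s]) @ u @ x" using br_sym[OF e] by (rule br_cong) simp
  also have "\<dots> \<approx> (?e @ [s]) @ u @ y" using br_cong[OF br_refl Cons.prems(1), of ?e] by simp
  also have "\<dots> \<approx> \<Delta> @ u @ y" using e by (rule br_cong) simp
  finally have "u @ x \<approx> u @ y" using Cons.prems by (intro Delta_left_cancel[of "u @ x"]) auto
  with Cons show ?case by simp
qed simp

subsection \<open>Products of n atoms\<close>

text \<open>As \<open>[]\<close> is an atom, this means a product of at most n atoms. It behaves
  well under products and factors and will measure the length of normal forms.\<close>

primrec atom_prod :: "nat \<Rightarrow> 'a list \<Rightarrow> bool" where
  "atom_prod 0 x \<longleftrightarrow> x = []"
| "atom_prod (Suc n) x \<longleftrightarrow> (\<exists>a y. atom S m a \<and> atom_prod n y \<and> x \<approx> a @ y)"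

lemma atom_prod_br: "x \<approx> y \<Longrightarrow> atom_prod n x \<Longrightarrow> atom_prod n y"
proof (induction n)
  case 0
  then show ?case using br_length[of x y] by simp
next
  case (Suc n)
  then obtain a z where a: "atom S m a" "atom_prod n z" "x \<approx> a @ z" by auto
  then have "y \<approx> a @ z" using Suc.prems(1) br_trans br_sym by blast
  with a show ?case by auto
qed

lemma atom_prod_in_lists: "atom_prod n x \<Longrightarrow> x \<in> Wd"
proof (induction n arbitrary: x)
  case (Suc n)
  then obtain a y where a: "atom S m a" "atom_prod n y" "x \<approx> a @ y" by auto
  then show ?case using Suc.IH br_in_lists[OF a(3)] atom_in_lists by simp
qed simp

lemma atom_prod_atom: "atom S m a \<Longrightarrow> atom_prod (Suc 0) a"
  by (auto intro: exI[of _ a])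

lemma atom_prod_append: "atom_prod n x \<Longrightarrow> atom_prod k y \<Longrightarrow> atom_prod (n + k) (x @ y)"
proof (induction n arbitrary: x)
  case (Suc n)
  then obtain a z where a: "atom S m a" "atom_prod n z" "x \<approx> a @ z" by auto
  have "x @ y \<approx> a @ z @ y" using br_cong[OF a(3) br_refl, of y] by simp
  with Suc.IH[OF a(2) Suc.prems(2)] a(1) show ?case by auto
qed simp

lemma atom_prod_Suc: "atom_prod n x \<Longrightarrow> atom_prod (Suc n) x"
  using atom_prod_append[OF atom_prod_atom[OF atom_Nil], of n x] by simp

lemma atom_prod_mono: "n \<le> k \<Longrightarrow> atom_prod n x \<Longrightarrow> atom_prod k x"
  by (induction k rule: dec_induct) (auto intro: atom_prod_Suc simp del: atom_prod.simps)

lemma atom_prod_rev: "atom_prod n x \<Longrightarrow> atom_prod n (rev x)"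
proof (induction n arbitrary: x)
  case (Suc n)
  then obtain a y where a: "atom S m a" "atom_prod n y" "x \<approx> a @ y" by auto
  have "atom_prod (n + Suc 0) (rev y @ rev a)"
    using Suc.IH[OF a(2)] a(1) by (intro atom_prod_append atom_prod_atom) (auto simp: atom_rev)
  then show ?case using atom_prod_br[OF br_sym[OF br_rev[OF a(3)]]] by (simp del: atom_prod.simps)
qed simp

lemma atom_prod_tau: "atom_prod n x \<Longrightarrow> atom_prod n (map tau x)"
proof (induction n arbitrary: x)
  case (Suc n)
  then obtain a y where a: "atom S m a" "atom_prod n y" "x \<approx> a @ y" by auto
  have "map tau x \<approx> map tau a @ map tau y"
    using tau_br[OF a(3)] atom_prod_in_lists[OF Suc.prems] by simp
  with Suc.IH[OF a(2)] atom_tau[OF a(1)] show ?case by auto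
qed simp

lemma atom_prod_tau_iff: "x \<in> Wd \<Longrightarrow> atom_prod n (map tau x) \<longleftrightarrow> atom_prod n x"
  using atom_prod_tau atom_prod_br[OF tau_tau] by blast

text \<open>The greedy choice is optimal: removing \<alpha>(a y) from a y takes away a and a prefix
  of \<alpha>(y), and leaves an atom followed by \<open>om y\<close>.\<close>

lemma atom_prod_om: "atom_prod (Suc n) x \<Longrightarrow> atom_prod n (om x)"
proof (induction n arbitrary: x)
  case 0
  then have x: "atom S m x" by (auto intro: atom_br br_sym)
  then have "length (om x) = 0"
    using br_length[OF al_om[of x]] br_length[OF al_atom[OF x]] by (auto dest: atom_in_lists)
  then show ?case by simp
next
  case (Suc n)
  then obtain a y where a: "atom S m a" "atom_prod (Suc n) y" "x \<approx> a @ y"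
    by (metis atom_prod.simps(2))
  let ?t = "ext a (al y)"
  have y: "y \<in> Wd" using a(2) by (rule atom_prod_in_lists)
  have x: "x \<in> Wd" using Suc.prems by (rule atom_prod_in_lists)
  have "atom S m (?t @ quo ?t (al y))"
    using quo(2)[OF ext_dvd[OF a(1) atom_al[OF y]]] atom_al[OF y] atom_br by blast
  then have "atom_prod (Suc n) (quo ?t (al y) @ om y)"
    using Suc.IH[OF a(2)] atom_append(2) by auto
  moreover have "om x \<approx> quo ?t (al y) @ om y"
    using om_br[OF a(3) x] al_om_append[OF y a(1)] br_trans by blast
  ultimately show ?case using atom_prod_br[OF br_sym] by blast
qed

text \<open>s divides \<alpha>(s x), so it can be removed inside that first factor without
  increasing the number of factors.\<close>

lemma atom_prod_Cons: assumes "atom_prod n (s # x)" shows "atom_prod n x"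
proof (cases n)
  case (Suc k)
  have w: "s # x \<in> Wd" using assms by (rule atom_prod_in_lists)
  then have s: "s \<in> S" by simp
  have "[s] \<preceq> s # x" using w left_dvd_append[of x "[s]"] by simp
  then have "[s] \<preceq> al (s # x)" using w atom_letter[OF s] al_greatest by blast
  then obtain c where c: "c \<in> Wd" "al (s # x) \<approx> [s] @ c" by (rule left_dvdE)
  have "atom S m c" using atom_br[OF c(2) atom_al[OF w]] atom_append(2)[of "[s]" c] by simp
  moreover have "atom_prod k (om (s # x))" using assms Suc atom_prod_om by blast
  ultimately have P: "atom_prod n (c @ om (s # x))" using Suc by auto
  have "s # x \<approx> ([s] @ c) @ om (s # x)"
    using al_om[OF w] br_cong[OF c(2) br_refl] br_trans by blast
  then have "x \<approx> c @ om (s # x)" using left_cancel[of "[s]" x "c @ om (s # x)"] w by simp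
  with P show ?thesis using atom_prod_br[OF br_sym] by blast
qed (use assms in simp)

lemma atom_prod_right: "atom_prod n (u @ x) \<Longrightarrow> atom_prod n x"
  by (induction u) (auto dest: atom_prod_Cons)

lemma atom_prod_left: "atom_prod n (x @ u) \<Longrightarrow> atom_prod n x"
  using atom_prod_rev[of n "x @ u"] atom_prod_right[of n "rev u" "rev x"] atom_prod_rev[of n "rev x"]
  by simp

lemma atom_prod_Delta: "atom_prod (Suc n) (\<Delta> @ x) \<Longrightarrow> atom_prod n x"
  using atom_prod_om[of n "\<Delta> @ x"] atom_prod_br[OF om_Delta[of x]] atom_prod_in_lists[of "Suc n" "\<Delta> @ x"]
  by simp

section \<open>The Artin group\<close>

abbreviation art (infix "\<cong>" 50) where "a \<cong> b \<equiv> art_eq S m a b"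
declare art_trans [trans] art_refl [simp, intro]

abbreviation gw where "gw \<equiv> gword S"

lemma gw_append [simp]: "gw (a @ b) \<longleftrightarrow> gw a \<and> gw b"
  and gw_Cons [simp]: "gw (x # b) \<longleftrightarrow> fst x \<in> S \<and> gw b"
  and gw_Nil [simp]: "gw []"
  by (auto simp: gword_def)

lemma gw_pos [simp]: "gw (pos x) \<longleftrightarrow> x \<in> Wd"
  by (auto simp: gword_def pos_def)

lemma pos_append [simp]: "pos (x @ y) = pos x @ pos y"
  and pos_Nil [simp]: "pos [] = []"
  and pos_Cons: "pos (s # x) = (s, True) # pos x"
  by (simp_all add: pos_def)

lemma inv_word_append [simp]: "inv_word (a @ b) = inv_word b @ inv_word a"
  and inv_word_Nil [simp]: "inv_word [] = []"
  and inv_word_Cons: "inv_word ((s, e) # b) = inv_word b @ [(s, \<not> e)]"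
  by (simp_all add: inv_word_def)

lemma gw_inv [simp]: "gw (inv_word a) \<longleftrightarrow> gw a"
  by (induction a) (auto simp: inv_word_Cons)

lemma inv_inv [simp]: "inv_word (inv_word a) = a"
  by (induction a) (auto simp: inv_word_Cons inv_word_append)

lemma art_context: "a \<cong> b \<Longrightarrow> x @ a @ y \<cong> x @ b @ y"
proof (induction rule: art_eq.induct)
  case (art_cancel s u b v)
  then show ?case using art_eq.art_cancel[of s S m "x @ u" b "v @ y"] by simp
next
  case (art_braid s t u v)
  then show ?case using art_eq.art_braid[of s S t m "x @ u" "v @ y"] by simp
qed (auto intro: art_sym art_trans)

lemma art_cong: "a \<cong> a' \<Longrightarrow> b \<cong> b' \<Longrightarrow> a @ b \<cong> a' @ b'"
  using art_context[of a a' "[]" b] art_context[of b b' a' "[]"]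
  by (auto intro: art_trans)

lemma art_right_inverse: "gw a \<Longrightarrow> a @ inv_word a \<cong> []"
proof (induction a rule: rev_induct)
  case (snoc x a)
  obtain s e where x: "x = (s, e)" by (cases x)
  have "a @ [(s, e), (s, \<not> e)] @ inv_word a \<cong> a @ inv_word a"
    using snoc x by (intro art_cancel) auto
  then show ?case using snoc x art_trans by (fastforce simp: inv_word_Cons)
qed simp

lemma art_left_inverse: "gw a \<Longrightarrow> inv_word a @ a \<cong> []"
  using art_right_inverse[of "inv_word a"] by simp

lemma art_move_left: assumes "gw u" shows "u @ x \<cong> y \<longleftrightarrow> x \<cong> inv_word u @ y"
proof -
  have 1: "inv_word u @ u @ z \<cong> z" and 2: "u @ inv_word u @ z \<cong> z" for z
    using art_cong[OF art_left_inverse[OF assms] art_refl, of z]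
      art_cong[OF art_right_inverse[OF assms] art_refl, of z] by simp_all
  show ?thesis
    using art_cong[OF art_refl, of "u @ x" y "inv_word u"] art_cong[OF art_refl, of x "inv_word u @ y" u]
      1[of x] 2[of y] art_trans art_sym by blast
qed

lemma art_move_right: assumes "gw u" shows "x @ u \<cong> y \<longleftrightarrow> x \<cong> y @ inv_word u"
proof -
  have 1: "(z @ u) @ inv_word u \<cong> z" and 2: "(z @ inv_word u) @ u \<cong> z" for z
    using art_cong[OF art_refl art_right_inverse[OF assms], of z]
      art_cong[OF art_refl art_left_inverse[OF assms], of z] by simp_all
  show ?thesis
    using art_cong[OF _ art_refl, of "x @ u" y "inv_word u"] art_cong[OF _ art_refl, of x "y @ inv_word u" u]
      1[of x] 2[of y] art_trans art_sym by blast
qed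

lemma art_gw: "a \<cong> b \<Longrightarrow> gw a \<longleftrightarrow> gw b"
  by (induction rule: art_eq.induct) (auto simp del: in_lists_conv_set)

lemma br_art: "x \<approx> y \<Longrightarrow> pos x \<cong> pos y"
proof (induction rule: br_eq.induct)
  case (br_braid s t u v)
  then show ?case using art_braid[of s S t m "pos u" "pos v"] by simp
qed (auto intro: art_sym art_trans)

text \<open>The inverse of s is \<open>\<Delta>\<^sup>-\<^sup>2\<close> times co s \<open>\<Delta>\<close>, and \<open>\<Delta>\<^sup>2\<close> is central. So clearing the
  denominators turns an equation in the Artin group into one in the monoid, which shows that the
  monoid embeds.\<close>
definition clear :: "'a gword \<Rightarrow> 'a list" where
  "clear a = concat (map (\<lambda>(s, e). if e then [s] else co s @ \<Delta>) a)"

definition negs :: "'a gword \<Rightarrow> nat" where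
  "negs a = length (filter (\<lambda>(s, e). \<not> e) a)"

definition sq_pow :: "nat \<Rightarrow> 'a list" where
  "sq_pow n = concat (replicate n (\<Delta> @ \<Delta>))"

lemma clear_append [simp]: "clear (a @ b) = clear a @ clear b"
  and clear_pos [simp]: "clear (pos x) = x"
  and negs_append [simp]: "negs (a @ b) = negs a + negs b"
  and negs_pos [simp]: "negs (pos x) = 0"
  by (induction x) (simp_all add: clear_def negs_def pos_def)

lemma clear_in_lists: "gw a \<Longrightarrow> clear a \<in> Wd"
proof (induction a)
  case (Cons x a)
  then show ?case using co_in_lists[of "fst x"] clear_append[of "[x]" a]
    by (cases x) (auto simp: clear_def)
qed (simp add: clear_def)

lemma sq_pow_add: "sq_pow (i + j) = sq_pow i @ sq_pow j"
  by (simp add: sq_pow_def replicate_add)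

lemma sq_pow_commute: "sq_pow i @ sq_pow j @ x = sq_pow j @ sq_pow i @ x"
  by (metis add.commute append.assoc sq_pow_add)

lemma sq_pow_in_lists [simp]: "sq_pow n \<in> Wd"
  by (induction n) (auto simp: sq_pow_def simp del: in_lists_conv_set)

lemma sq_central: assumes "x \<in> Wd" shows "x @ \<Delta> @ \<Delta> \<approx> (\<Delta> @ \<Delta>) @ x"
proof -
  have "x @ \<Delta> @ \<Delta> \<approx> \<Delta> @ map tau x @ \<Delta>"
    using br_cong[OF word_Delta[OF assms] br_refl, of \<Delta>] by simp
  also have "\<dots> \<approx> \<Delta> @ \<Delta> @ x"
    using br_cong[OF br_refl br_sym[OF Delta_word[OF assms]]] .
  finally show ?thesis by simp
qed

lemma clear_cancel: assumes s: "s \<in> S" shows "clear [(s, b), (s, \<not> b)] \<approx> \<Delta> @ \<Delta>"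
proof (cases b)
  case True
  then show ?thesis using br_cong[OF letter_co[OF s] br_refl, of \<Delta>] by (simp add: clear_def)
next
  case False
  have "co s @ \<Delta> @ [s] \<approx> co s @ [tau s] @ \<Delta>"
    by (rule br_cong[OF br_refl Delta_letter[OF s]])
  also have "\<dots> \<approx> \<Delta> @ \<Delta>" using br_cong[OF co_letter[OF s] br_refl, of \<Delta>] by simp
  finally show ?thesis using False by (simp add: clear_def)
qed

text \<open>In the group, a is \<Delta>^(-2 \<open>negs a\<close>) times \<open>clear a\<close>, so
  this is a = b with denominators multiplied crosswise. Transitivity cancels the power belonging to
  the middle word.\<close>

lemma art_clear:
  assumes "a \<cong> b" "gw a"
  shows "sq_pow (negs b) @ clear a \<approx> sq_pow (negs a) @ clear b"
  using assms
proof (induction rule: art_eq.induct)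
  case (art_sym u w)
  then show ?case using art_gw br_sym by blast
next
  case (art_trans a b c)
  have gw: "gw a" "gw b" "gw c" using art_trans art_gw by blast+
  let ?A = "sq_pow (negs a)" and ?B = "sq_pow (negs b)" and ?C = "sq_pow (negs c)"
  have "?B @ ?C @ clear a = ?C @ ?B @ clear a" by (rule sq_pow_commute)
  also have "\<dots> \<approx> ?C @ ?A @ clear b"
    using br_cong[OF br_refl art_trans.IH(1)] gw by simp
  also have "?C @ ?A @ clear b = ?A @ ?C @ clear b" by (rule sq_pow_commute)
  also have "?A @ ?C @ clear b \<approx> ?A @ ?B @ clear c"
    using br_cong[OF br_refl art_trans.IH(2)] gw by simp
  also have "?A @ ?B @ clear c = ?B @ ?A @ clear c" by (rule sq_pow_commute)
  finally show ?case using left_cancel[of ?B "?C @ clear a" "?A @ clear c"] gw clear_in_lists by simp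
next
  case (art_cancel s u b v)
  let ?n = "negs (u @ v)"
  have "clear (u @ [(s, b), (s, \<not> b)] @ v) \<approx> clear u @ (\<Delta> @ \<Delta>) @ clear v"
    unfolding clear_append using clear_cancel art_cancel by (intro br_cong) auto
  also have "\<dots> \<approx> (\<Delta> @ \<Delta>) @ clear (u @ v)"
    using br_cong[OF sq_central[of "clear u"] br_refl, of "clear v"] art_cancel clear_in_lists by simp
  finally have "sq_pow ?n @ clear (u @ [(s, b), (s, \<not> b)] @ v) \<approx> sq_pow ?n @ (\<Delta> @ \<Delta>) @ clear (u @ v)"
    by (intro br_cong) auto
  also have "sq_pow ?n @ (\<Delta> @ \<Delta>) @ clear (u @ v) = sq_pow (?n + 1) @ clear (u @ v)"
    unfolding sq_pow_add by (simp add: sq_pow_def)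
  also have "?n + 1 = negs (u @ [(s, b), (s, \<not> b)] @ v)"
    by (simp add: negs_def)
  finally show ?case .
next
  case (art_braid s t u v)
  have "clear u @ alt s t (m s t) @ clear v \<approx> clear u @ alt t s (m s t) @ clear v"
    using art_braid br_alt by (intro br_cong) auto
  then show ?case by (simp add: br_cong)
qed simp

lemma art_br: assumes "pos x \<cong> pos y" "x \<in> Wd" shows "x \<approx> y"
  using art_clear[OF assms(1)] assms(2) by (simp add: sq_pow_def)

subsection \<open>Normal forms and norms\<close>

lemma le_pos_iff: assumes "y \<in> Wd" shows "le_pos S m x y \<longleftrightarrow> x \<preceq> y"
proof
  assume "le_pos S m x y"
  then obtain z where z: "z \<in> Wd" "pos y \<cong> pos (x @ z)" by (auto simp: le_pos_def)
  from art_br[OF z(2) assms] z(1) show "x \<preceq> y" by (rule left_dvdI[rotated])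
next
  assume "x \<preceq> y"
  then obtain z where z: "z \<in> Wd" "y \<approx> x @ z" by (rule left_dvdE)
  then have "set z \<subseteq> S" "pos y \<cong> pos x @ pos z" using br_art[OF z(2)] by auto
  then show "le_pos S m x y" unfolding le_pos_def by blast
qed

lemma is_alpha_iff: assumes g: "g \<in> Wd" shows "is_alpha S m a g \<longleftrightarrow> a \<approx> al g"
proof
  assume a: "is_alpha S m a g"
  then have at: "atom S m a" by (simp add: is_alpha_def)
  have "al g \<preceq> a"
    using a g al_dvd[OF g] atom_in_lists[OF at] by (auto simp: is_alpha_def le_pos_iff)
  moreover have "a \<preceq> al g" using a g by (auto simp: is_alpha_def le_pos_iff intro: al_greatest)
  ultimately show "a \<approx> al g" by (intro left_dvd_antisym)
next
  assume a: "a \<approx> al g"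
  have at: "atom S m a" using atom_br[OF br_sym[OF a]] g by simp
  have "b \<preceq> a" if "atom S m b" "b \<preceq> g" for b
    using al_greatest[OF g that] br_sym[OF a] left_dvd_br_trans by blast
  moreover have "a \<preceq> g" using a al_dvd[OF g] by (rule br_left_dvd_trans)
  ultimately show "is_alpha S m a g"
    using at atom_in_lists[OF at] g by (auto simp: is_alpha_def le_pos_iff)
qed

lemma is_nf_Cons:
  "is_nf S m (A # As) \<longleftrightarrow> A \<noteq> [] \<and> is_alpha S m A (A @ concat As) \<and> is_nf S m As"
  by (auto simp: is_nf_def All_less_Suc2 nth_Cons split: nat.splits)

lemma is_nf_atoms: "is_nf S m As \<Longrightarrow> A \<in> set As \<Longrightarrow> atom S m A"
  by (auto simp: is_nf_def is_alpha_def in_set_conv_nth)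

lemma concat_atoms_in_lists: "(\<And>A. A \<in> set As \<Longrightarrow> atom S m A) \<Longrightarrow> concat As \<in> Wd"
  by (induction As) (auto simp: atom_in_lists simp del: in_lists_conv_set)

lemma is_nf_in_lists: "is_nf S m As \<Longrightarrow> concat As \<in> Wd"
  using is_nf_atoms concat_atoms_in_lists by blast

lemma is_nf_ConsD:
  assumes "is_nf S m (A # As)"
  shows "A \<noteq> []" "is_nf S m As" "A \<approx> al (A @ concat As)"
  using assms is_alpha_iff[OF is_nf_in_lists[OF assms]] by (auto simp: is_nf_Cons)

lemma nf_exists: "w \<in> Wd \<Longrightarrow> \<exists>As. is_nf S m As \<and> concat As \<approx> w"
proof (induction "length w" arbitrary: w rule: less_induct)
  case less
  show ?case
  proof (cases w)
    case Nil
    then show ?thesis by (auto simp: is_nf_def intro!: exI[of _ "[]"])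
  next
    case (Cons s v)
    have ne: "al w \<noteq> []" using Cons by simp
    have ao: "w \<approx> al w @ om w" using al_om[OF less.prems] .
    have "length (om w) < length w" using br_length[OF ao] ne by simp
    then obtain Bs where Bs: "is_nf S m Bs" "concat Bs \<approx> om w"
      using less om_in_lists by blast
    have w: "w \<approx> al w @ concat Bs"
      using ao br_cong[OF br_refl br_sym[OF Bs(2)]] br_trans by blast
    then have "is_alpha S m (al w) (al w @ concat Bs)"
      using is_alpha_iff[of "al w @ concat Bs"] al_br[OF w less.prems] br_in_lists[OF w] less.prems
      by simp
    then have "is_nf S m (al w # Bs)" using ne Bs by (simp add: is_nf_Cons)
    moreover have "concat (al w # Bs) \<approx> w" using br_sym[OF w] by simp
    ultimately show ?thesis by blast
  qed
qed

lemma atom_prod_concat: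
  "(\<And>A. A \<in> set As \<Longrightarrow> atom S m A) \<Longrightarrow> atom_prod (length As) (concat As)"
  by (induction As) auto

text \<open>The normal form uses the fewest possible atoms, so any factorization bounds the atomnorm
  from above.\<close>

lemma nf_length_le_iff:
  assumes "is_nf S m As"
  shows "length As \<le> n \<longleftrightarrow> atom_prod n (concat As)"
proof
  assume "length As \<le> n"
  then show "atom_prod n (concat As)"
    using atom_prod_mono atom_prod_concat is_nf_atoms[OF assms] by blast
next
  show "atom_prod n (concat As) \<Longrightarrow> length As \<le> n"
    using assms
  proof (induction As arbitrary: n)
    case (Cons A As)
    let ?w = "A @ concat As"
    note nf = is_nf_ConsD[OF Cons.prems(2)]
    obtain k where k: "n = Suc k" using Cons.prems(1) nf(1) by (cases n) auto
    have w: "?w \<in> Wd" using is_nf_in_lists[OF Cons.prems(2)] by simp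
    have "?w \<approx> A @ om ?w"
      using al_om[OF w] br_cong[OF br_sym[OF nf(3)] br_refl] br_trans by blast
    then have "concat As \<approx> om ?w" using left_cancel[of A "concat As"] w by simp
    moreover have "atom_prod k (om ?w)" using Cons.prems(1) k atom_prod_om[of k ?w] by simp
    ultimately have "atom_prod k (concat As)" using atom_prod_br br_sym by blast
    then show ?case using Cons.IH nf(2) k by simp
  qed simp
qed

section \<open>Integral powers of \<Delta>\<close>

definition Delta_pow :: "nat \<Rightarrow> 'a list" where
  "Delta_pow n = concat (replicate n \<Delta>)"

lemma Delta_pow_0 [simp]: "Delta_pow 0 = []"
  and Delta_pow_Suc: "Delta_pow (Suc n) = \<Delta> @ Delta_pow n"
  by (simp_all add: Delta_pow_def)

lemma Delta_pow_in_lists [simp]: "Delta_pow n \<in> Wd"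
  by (induction n) (auto simp: Delta_pow_Suc simp del: in_lists_conv_set)

abbreviation dp where "dp \<equiv> delta_pow S m"

lemma dp_0 [simp]: "dp 0 = []"
  by (simp add: delta_pow_def)

lemma dp_nat: "dp (int n) = pos (Delta_pow n)"
  by (induction n) (simp_all add: delta_pow_def Delta_pow_def nat_add_distrib)

lemma gw_dp [simp]: "gw (dp k)"
proof -
  have "gw (concat (replicate n x))" if "gw x" for n x
    using that by (induction n) auto
  then show ?thesis by (simp add: delta_pow_def)
qed

lemma dp_Suc: "dp (k + 1) \<cong> dp k @ pos \<Delta>"
proof (cases "k \<ge> 0")
  case True
  then have "nat (k + 1) = Suc (nat k)" by simp
  then show ?thesis
    using True by (simp add: delta_pow_def replicate_append_same[symmetric] del: replicate_Suc)
      (simp flip: replicate_append_same)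
next
  case False
  define n where "n = nat (- (k + 1))"
  have k: "nat (- k) = Suc n" "k + 1 \<ge> 0 \<Longrightarrow> n = 0" using False by (auto simp: n_def)
  let ?I = "inv_word (pos \<Delta>)"
  have "dp k = concat (replicate n ?I) @ ?I"
    using False k(1) by (simp add: delta_pow_def flip: replicate_append_same)
  moreover have "dp (k + 1) = concat (replicate n ?I)"
    using k False by (auto simp: delta_pow_def n_def)
  ultimately show ?thesis by (simp add: art_move_right art_sym flip: append_assoc)
qed

lemma dp_pred: "dp (k - 1) \<cong> dp k @ inv_word (pos \<Delta>)"
  using art_sym[OF dp_Suc[of "k - 1"]] art_move_right[of "pos \<Delta>" "dp (k - 1)" "dp k"] by simp

lemma dp_add: "dp (j + k) \<cong> dp j @ dp k"
proof (induction k rule: int_induct[where k = 0])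
  case (step1 k)
  have "dp (j + k + 1) \<cong> dp (j + k) @ pos \<Delta>" by (rule dp_Suc)
  also have "\<dots> \<cong> (dp j @ dp k) @ pos \<Delta>" using step1 by (intro art_cong) auto
  also have "\<dots> \<cong> dp j @ dp (k + 1)" using art_cong[OF art_refl art_sym[OF dp_Suc]] by simp
  finally show ?case by (simp add: add.assoc)
next
  case (step2 k)
  have "dp (j + k - 1) \<cong> dp (j + k) @ inv_word (pos \<Delta>)" by (rule dp_pred)
  also have "\<dots> \<cong> (dp j @ dp k) @ inv_word (pos \<Delta>)" using step2 by (intro art_cong) auto
  also have "\<dots> \<cong> dp j @ dp (k - 1)" using art_cong[OF art_refl art_sym[OF dp_pred]] by simp
  finally show ?case by (simp add: algebra_simps)
qed simp

lemma dp_dp_minus: "dp k @ dp (- k) \<cong> []"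
  using art_sym[OF dp_add[of k "- k"]] by simp

lemma art_move_dp: "x @ dp k \<cong> y \<longleftrightarrow> x \<cong> y @ dp (- k)"
proof -
  have "(z @ dp k) @ dp (- k) \<cong> z" "(z @ dp (- k)) @ dp k \<cong> z" for z
    using art_cong[OF art_refl dp_dp_minus, of z k] art_cong[OF art_refl dp_dp_minus, of z "- k"] by simp_all
  then show ?thesis
    using art_cong[OF _ art_refl, of "x @ dp k" y "dp (- k)"] art_cong[OF _ art_refl, of x "y @ dp (- k)" "dp k"]
      art_trans art_sym by blast
qed

text \<open>The k-th power of \<open>tau\<close>, which depends only on the parity of k.\<close>

definition twist :: "int \<Rightarrow> 'a list \<Rightarrow> 'a list" where
  "twist k x = (if even k then x else map tau x)"

lemma length_twist [simp]: "length (twist k x) = length x"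
  and twist_in_lists [simp]: "x \<in> Wd \<Longrightarrow> twist k x \<in> Wd"
  and Delta_dvd_twist: "x \<in> Wd \<Longrightarrow> \<Delta> \<preceq> twist k x \<longleftrightarrow> \<Delta> \<preceq> x"
  and atom_prod_twist: "x \<in> Wd \<Longrightarrow> atom_prod n (twist k x) \<longleftrightarrow> atom_prod n x"
  by (simp_all add: twist_def Delta_dvd_tau atom_prod_tau_iff map_tau_in_lists del: in_lists_conv_set)

lemma twist_twist: "x \<in> Wd \<Longrightarrow> twist k (twist k x) \<approx> x"
  using tau_tau by (simp add: twist_def del: map_map)

lemma map_tau_twist:
  assumes "x \<in> Wd" shows "map tau (twist k x) \<approx> twist (k + 1) x" "map tau (twist k x) \<approx> twist (k - 1) x"
  using tau_tau[OF assms] by (simp_all add: twist_def del: map_map)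

lemma dp_commute: "x \<in> Wd \<Longrightarrow> dp k @ pos x \<cong> pos (twist k x) @ dp k"
proof (induction k arbitrary: x rule: int_induct[where k = 0])
  case base
  then show ?case by (simp add: twist_def)
next
  case (step1 k)
  have "dp (k + 1) @ pos x \<cong> dp k @ pos (\<Delta> @ x)"
    using art_cong[OF dp_Suc art_refl, of k "pos x"] by simp
  also have "\<dots> \<cong> dp k @ pos (map tau x @ \<Delta>)"
    by (intro art_cong art_refl br_art Delta_word step1.prems)
  also have "\<dots> \<cong> pos (twist k (map tau x)) @ dp k @ pos \<Delta>"
    using art_cong[OF step1.IH art_refl, of "map tau x" "pos \<Delta>"] step1.prems by simp
  also have "twist k (map tau x) = map tau (twist k x)" by (simp add: twist_def)
  also have "pos (map tau (twist k x)) @ dp k @ pos \<Delta> \<cong> pos (twist (k + 1) x) @ dp (k + 1)"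
    using step1.prems by (intro art_cong br_art map_tau_twist art_sym[OF dp_Suc])
  finally show ?case .
next
  case (step2 k)
  have D: "inv_word (pos \<Delta>) @ pos x \<cong> pos (map tau x) @ inv_word (pos \<Delta>)"
  proof -
    have "pos x @ pos \<Delta> \<cong> pos \<Delta> @ pos (map tau x)" using br_art[OF word_Delta[OF step2.prems]] by simp
    then have "inv_word (pos \<Delta>) @ pos x @ pos \<Delta> \<cong> pos (map tau x)"
      by (subst art_sym, subst art_move_left[symmetric]) (auto intro: art_sym)
    then show ?thesis using art_move_right[of "pos \<Delta>" "inv_word (pos \<Delta>) @ pos x"] by simp
  qed
  have "dp (k - 1) @ pos x \<cong> dp k @ inv_word (pos \<Delta>) @ pos x"
    using art_cong[OF dp_pred art_refl, of k "pos x"] by simp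
  also have "\<dots> \<cong> dp k @ pos (map tau x) @ inv_word (pos \<Delta>)"
    by (intro art_cong art_refl D)
  also have "\<dots> \<cong> pos (twist k (map tau x)) @ dp k @ inv_word (pos \<Delta>)"
    using art_cong[OF step2.IH art_refl, of "map tau x" "inv_word (pos \<Delta>)"] step2.prems by simp
  also have "twist k (map tau x) = map tau (twist k x)" by (simp add: twist_def)
  also have "pos (map tau (twist k x)) @ dp k @ inv_word (pos \<Delta>) \<cong> pos (twist (k - 1) x) @ dp (k - 1)"
    using step2.prems by (intro art_cong br_art map_tau_twist art_sym[OF dp_pred])
  finally show ?case .
qed

section \<open>Special representatives and evaluation of the norms\<close>

lemma Delta_pow_dvd:
  assumes "w \<in> Wd" "n > 0" shows "\<Delta> \<preceq> w @ Delta_pow n"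
proof -
  obtain k where "n = Suc k" using assms(2) by (cases n) auto
  then have "w @ Delta_pow n \<approx> \<Delta> @ map tau w @ Delta_pow k"
    using br_cong[OF word_Delta[OF assms(1)] br_refl, of "Delta_pow k"] by (simp add: Delta_pow_Suc)
  with assms show ?thesis by (intro left_dvdI[of "map tau w @ Delta_pow k"]) auto
qed

text \<open>A negative power is moved to the other side. A positive power on the right can be moved
  to the front, so \<Delta> would divide a special word.\<close>

lemma special_unique:
  assumes u: "u \<in> Wd" "\<not> \<Delta> \<preceq> u" and w: "w \<in> Wd" "\<not> \<Delta> \<preceq> w" and eq: "pos u \<cong> pos w @ dp k"
  shows "u \<approx> w"
proof -
  have *: "x \<approx> y" if "x \<in> Wd" "\<not> \<Delta> \<preceq> x" "y \<in> Wd" "pos x \<cong> pos y @ dp (int n)" for x y n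
  proof -
    have "pos x \<cong> pos (y @ Delta_pow n)" using that(4) by (simp add: dp_nat)
    then have xy: "x \<approx> y @ Delta_pow n" using that(1) by (rule art_br)
    then have "n = 0"
      using Delta_pow_dvd[OF that(3), of n] that(2) left_dvd_br_trans br_sym by blast
    with xy show ?thesis by simp
  qed
  show ?thesis
  proof (cases "k \<ge> 0")
    case True
    then show ?thesis using *[of u w "nat k"] u w eq by simp
  next
    case False
    have "pos w \<cong> pos u @ dp (- k)" using eq art_move_dp[of "pos w" k "pos u"] art_sym by blast
    then show ?thesis using *[of w u "nat (- k)"] u w False br_sym by simp
  qed
qed

lemma art_Delta_iff: "atom S m A \<Longrightarrow> pos A \<cong> pos \<Delta> \<longleftrightarrow> \<Delta> \<preceq> A"
  using art_br[of A \<Delta>] atom_in_lists[of A] atom_le_Delta[of A] left_dvd_antisym[of A \<Delta>]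
    br_art[of A \<Delta>] br_left_dvd br_sym by blast

text \<open>Without generators \<Delta> is empty and divides everything; hence the assumption on S
  in the lemmas on norms.\<close>

lemma Delta_nonempty: assumes "S \<noteq> {}" shows "\<not> \<Delta> \<preceq> []"
proof -
  obtain s where "s \<in> S" using assms by blast
  then have "[s] \<preceq> \<Delta>" by (intro atom_le_Delta atom_letter)
  then show ?thesis using left_dvd_length[of "[s]" \<Delta>] left_dvd_length[of \<Delta> "[]"] by auto
qed

text \<open>A \<Delta> among the atoms moves to the front past the others; conversely, if \<Delta>
  divides the product, it divides the first atom.\<close>

lemma nf_no_Delta_iff:
  assumes "S \<noteq> {}" "is_nf S m As"
  shows "(\<forall>i<length As. \<not> pos (As ! i) \<cong> pos \<Delta>) \<longleftrightarrow> \<not> \<Delta> \<preceq> concat As"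
proof -
  have "\<Delta> \<preceq> concat As" if A: "A \<in> set As" "\<Delta> \<preceq> A" for A
  proof -
    obtain xs ys where As: "As = xs @ A # ys" using split_list[OF A(1)] by blast
    have lists: "concat xs \<in> Wd" "concat ys \<in> Wd" "A \<in> Wd" using is_nf_in_lists[OF assms(2)] As by auto
    from A(2) obtain z where z: "z \<in> Wd" "A \<approx> \<Delta> @ z" by (rule left_dvdE)
    have "concat As \<approx> (concat xs @ \<Delta>) @ z @ concat ys"
      using br_context[OF z(2), of "concat xs" "concat ys"] As by simp
    also have "\<dots> \<approx> (\<Delta> @ map tau (concat xs)) @ z @ concat ys"
      using word_Delta[OF lists(1)] by (rule br_cong) simp
    finally show ?thesis
      using lists z map_tau_in_lists[of "concat xs"] left_dvdI[of "map tau (concat xs) @ z @ concat ys"]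
      by (simp del: in_lists_conv_set)
  qed
  moreover have "\<exists>A\<in>set As. \<Delta> \<preceq> A" if "\<Delta> \<preceq> concat As"
  proof (cases As)
    case Nil
    with that Delta_nonempty[OF assms(1)] show ?thesis by simp
  next
    case (Cons A Bs)
    have "\<Delta> \<preceq> al (concat As)" using that is_nf_in_lists[OF assms(2)] Delta_dvd_iff_al by blast
    also have "al (concat As) \<approx> A" using is_nf_ConsD(3)[of A Bs] assms(2) Cons br_sym by simp
    finally show ?thesis using Cons by simp
  qed
  ultimately have "(\<forall>A\<in>set As. \<not> \<Delta> \<preceq> A) \<longleftrightarrow> \<not> \<Delta> \<preceq> concat As" by blast
  then show ?thesis
    using art_Delta_iff[OF is_nf_atoms[OF assms(2)]] by (simp add: all_set_conv_all_nth)
qed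

text \<open>This evaluates the choices in both norms. The right power of \<Delta> leaves the vertex
  unchanged; the left one applies a power of \<open>tau\<close>, which preserves length, atom count
  and divisibility by \<Delta>.\<close>

lemma norms:
  assumes S: "S \<noteq> {}" and w: "w \<in> Wd" "\<not> \<Delta> \<preceq> w" and y: "y \<cong> dp j @ pos w @ dp k"
  shows "wordnorm S m y = length w \<and> (atomnorm S m y \<le> n \<longleftrightarrow> atom_prod n w)"
proof -
  let ?w = "twist j w"
  have w': "?w \<in> Wd" "\<not> \<Delta> \<preceq> ?w" using w Delta_dvd_twist by auto
  have "y \<cong> (pos ?w @ dp j) @ dp k"
    using art_trans[OF y] art_cong[OF dp_commute[OF w(1), of j] art_refl, of "dp k"] by simp
  also have "\<dots> \<cong> pos ?w @ dp (j + k)"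
    using art_cong[OF art_refl art_sym[OF dp_add]] by simp
  finally have yw: "y \<cong> pos ?w @ dp (j + k)" .
  then have wy: "pos ?w \<cong> y @ dp (- (j + k))"
    using art_move_dp art_sym by blast
  obtain As where As: "is_nf S m As" "concat As \<approx> ?w" using nf_exists[OF w'(1)] by blast
  have "special_nf S m y As"
    unfolding special_nf_def coset_eq_def
    using As nf_no_Delta_iff[OF S As(1)] w'(2) left_dvd_br_trans br_art[OF As(2)] wy art_trans by blast
  then have Bs: "special_nf S m y (SOME As. special_nf S m y As)" (is "special_nf S m y ?Bs")
    by (rule someI)
  then have nf: "is_nf S m ?Bs" and free: "\<not> \<Delta> \<preceq> concat ?Bs"
    using nf_no_Delta_iff[OF S] by (auto simp: special_nf_def)
  from Bs obtain k' where "pos (concat ?Bs) \<cong> y @ dp k'"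
    by (auto simp: special_nf_def coset_eq_def)
  also have "y @ dp k' \<cong> (pos ?w @ dp (j + k)) @ dp k'" using yw by (rule art_cong) simp
  also have "\<dots> \<cong> pos ?w @ dp (j + k + k')"
    using art_cong[OF art_refl art_sym[OF dp_add]] by simp
  finally have eq: "concat ?Bs \<approx> ?w"
    using special_unique is_nf_in_lists[OF nf] free w' by blast
  then have "atom_prod n (concat ?Bs) \<longleftrightarrow> atom_prod n w"
    using atom_prod_br br_sym atom_prod_twist[OF w(1)] by blast
  then show ?thesis
    using br_length[OF eq] nf_length_le_iff[OF nf] by (simp add: wordnorm_def atomnorm_def)
qed

lemma strip_Delta:
  assumes "S \<noteq> {}" "x \<in> Wd"
  obtains n y where "y \<in> Wd" "x \<approx> Delta_pow n @ y" "\<not> \<Delta> \<preceq> y"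
proof -
  have "\<exists>n y. y \<in> Wd \<and> x \<approx> Delta_pow n @ y \<and> \<not> \<Delta> \<preceq> y"
    using assms(2)
  proof (induction "length x" arbitrary: x rule: less_induct)
    case less
    show ?case
    proof (cases "\<Delta> \<preceq> x")
      case True
      then obtain z where z: "z \<in> Wd" "x \<approx> \<Delta> @ z" by (rule left_dvdE)
      have "\<Delta> \<noteq> []" using Delta_nonempty[OF assms(1)] by auto
      then have "length z < length x" using br_length[OF z(2)] by simp
      then obtain n y where y: "y \<in> Wd" "z \<approx> Delta_pow n @ y" "\<not> \<Delta> \<preceq> y" using less z by blast
      have "x \<approx> Delta_pow (Suc n) @ y"
        using br_trans[OF z(2) br_cong[OF br_refl y(2)]] by (simp add: Delta_pow_Suc)
      with y show ?thesis by blast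
    next
      case False
      with less.prems show ?thesis by (intro exI[of _ 0] exI[of _ x]) simp
    qed
  qed
  with that show ?thesis by blast
qed

lemma atomnorm_le:
  assumes S: "S \<noteq> {}" and x: "atom_prod n x" and y: "y \<cong> dp j @ pos x @ dp k"
  shows "atomnorm S m y \<le> n"
proof -
  obtain i w where w: "w \<in> Wd" "x \<approx> Delta_pow i @ w" "\<not> \<Delta> \<preceq> w"
    using strip_Delta[OF S atom_prod_in_lists[OF x]] .
  have "atom_prod n w" using atom_prod_br[OF w(2) x] by (rule atom_prod_right)
  moreover have "y \<cong> dp (j + int i) @ pos w @ dp k"
  proof -
    have "y \<cong> dp j @ (dp (int i) @ pos w) @ dp k"
      using art_trans[OF y art_cong[OF art_refl art_cong[OF br_art[OF w(2)] art_refl]]] by (simp add: dp_nat)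
    also have "\<dots> \<cong> dp (j + int i) @ pos w @ dp k"
      using art_cong[OF art_sym[OF dp_add[of j "int i"]] art_refl, of "pos w @ dp k"] by simp
    finally show ?thesis .
  qed
  ultimately show ?thesis using norms[OF S w(1) w(3)] by blast
qed

lemma group_word_form:
  assumes "gw y" obtains j x where "x \<in> Wd" "y \<cong> dp j @ pos x"
proof -
  have "\<exists>j x. x \<in> Wd \<and> y \<cong> dp j @ pos x"
    using assms
  proof (induction y)
    case Nil
    then show ?case by (intro exI[of _ 0] exI[of _ "[]"]) simp
  next
    case (Cons l y)
    obtain s e where l: "l = (s, e)" by (cases l)
    have s: "s \<in> S" using Cons.prems l by simp
    from Cons obtain j x where x: "x \<in> Wd" "y \<cong> dp j @ pos x" by auto
    have letter: "\<exists>i z. z \<in> Wd \<and> [l] \<cong> pos z @ dp i"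
    proof (cases e)
      case True
      then show ?thesis using l s by (intro exI[of _ 0] exI[of _ "[s]"]) (simp add: pos_def)
    next
      case False
      \<comment> \<open>The inverse of s is \<open>co s\<close> times \<Delta>^(-1).\<close>
      have "[(s, True)] @ pos (co s) \<cong> dp 1"
        using br_art[OF letter_co[OF s]] dp_nat[of 1] by (simp add: pos_Cons Delta_pow_Suc)
      then have "pos (co s) \<cong> [l] @ dp 1"
        using art_move_left[of "[(s, True)]" "pos (co s)" "dp 1"] s l False by (simp add: inv_word_def)
      then have "[l] \<cong> pos (co s) @ dp (- 1)" using art_move_dp art_sym by blast
      then show ?thesis using co_in_lists[OF s] by blast
    qed
    then obtain i z where z: "z \<in> Wd" "[l] \<cong> pos z @ dp i" by blast
    have "l # y \<cong> (pos z @ dp i) @ dp j @ pos x" using art_cong[OF z(2) x(2)] by simp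
    also have "\<dots> \<cong> pos z @ dp (i + j) @ pos x"
      using art_cong[OF art_refl art_cong[OF art_sym[OF dp_add[of i j]] art_refl], of "pos z" "pos x"] by simp
    also have "\<dots> \<cong> (dp (i + j) @ pos (twist (i + j) z)) @ pos x"
    proof -
      have "dp (i + j) @ pos (twist (i + j) z) \<cong> pos (twist (i + j) (twist (i + j) z)) @ dp (i + j)"
        using z by (intro dp_commute) simp
      also have "\<dots> \<cong> pos z @ dp (i + j)" using z by (intro art_cong br_art twist_twist) auto
      finally show ?thesis using art_cong[OF art_sym art_refl] by (metis append.assoc)
    qed
    finally have "l # y \<cong> dp (i + j) @ pos (twist (i + j) z @ x)" by simp
    moreover have "twist (i + j) z @ x \<in> Wd" using z x by simp
    ultimately show ?case by blast
  qed
  with that show ?thesis by blast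
qed

subsection \<open>Geodesics\<close>

text \<open>Whether \<open>\<Delta>\<close> divides \<open>g B\<^sub>1 \<cdots> B\<^sub>k\<close> is decided by \<open>g B\<^sub>1\<close>. So along the
  geodesic either each step gains a \<open>\<Delta>\<close> or no later step does.\<close>
lemma Delta_dichotomy:
  assumes "g \<in> Wd" "is_nf S m As" "i \<le> length As"
  shows "(\<exists>h\<in>Wd. g @ concat (take i As) \<approx> Delta_pow i @ h)
    \<or> (\<exists>n. \<exists>h\<in>Wd. g @ concat (take i As) \<approx> Delta_pow n @ h \<and> \<not> \<Delta> \<preceq> h @ concat (drop i As))"
  using assms
proof (induction i arbitrary: g As)
  case (Suc i)
  then obtain B Bs where As: "As = B # Bs" by (cases As) auto
  have w: "B @ concat Bs \<in> Wd" using is_nf_in_lists[OF Suc.prems(2)] As by simp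
  note nf = is_nf_ConsD[OF Suc.prems(2)[unfolded As]]
  have i: "concat (take (Suc i) As) = B @ concat (take i Bs)" "concat (drop (Suc i) As) = concat (drop i Bs)"
    using As by auto
  show ?case
  proof (cases "\<Delta> \<preceq> g @ B")
    case True
    then obtain h where h: "h \<in> Wd" "g @ B \<approx> \<Delta> @ h" by (rule left_dvdE)
    have step: "g @ concat (take (Suc i) As) \<approx> Delta_pow (Suc n) @ h'"
      if "h @ concat (take i Bs) \<approx> Delta_pow n @ h'" for n h'
    proof -
      have "g @ concat (take (Suc i) As) \<approx> \<Delta> @ h @ concat (take i Bs)"
        using br_cong[OF h(2) br_refl, of "concat (take i Bs)"] i by simp
      also have "\<dots> \<approx> \<Delta> @ Delta_pow n @ h'" using that by (rule br_cong[OF br_refl])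
      finally show ?thesis by (simp add: Delta_pow_Suc)
    qed
    show ?thesis
      using Suc.IH[OF h(1) nf(2)] Suc.prems(3) As step i(2) by fastforce
  next
    case False
    \<comment> \<open>B is \<alpha> of everything that follows g, so if \<Delta> does not divide g
      B, it does not divide the full product.\<close>
    have "g @ al (B @ concat Bs) \<approx> g @ B" using br_cong[OF br_refl br_sym[OF nf(3)]] .
    then have "\<not> \<Delta> \<preceq> g @ B @ concat Bs"
      using False Delta_dvd_append_al[OF Suc.prems(1) w] left_dvd_br_trans by blast
    moreover have "concat Bs = concat (take i Bs) @ concat (drop i Bs)"
      by (metis append_take_drop_id concat_append)
    ultimately have "\<not> \<Delta> \<preceq> (g @ concat (take (Suc i) As)) @ concat (drop (Suc i) As)"
      using i by simp
    moreover have "g @ concat (take (Suc i) As) \<in> Wd"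
      using i w \<open>concat Bs = _\<close> Suc.prems(1) by simp
    ultimately show ?thesis by (intro disjI2 exI[of _ 0] bexI) auto
  qed
qed (auto intro: bexI[of _ g])

text \<open>The inverse of n atoms is a product of n atoms up to \<Delta>^n. This bounds d_at along
  the geodesic traversed backwards.\<close>

lemma left_complement:
  assumes "\<And>A. A \<in> set As \<Longrightarrow> atom S m A"
  shows "\<exists>x. atom_prod (length As) x \<and> x @ concat As \<approx> Delta_pow (length As)"
  using assms
proof (induction As)
  case (Cons A As)
  then obtain x where x: "atom_prod (length As) x" "x @ concat As \<approx> Delta_pow (length As)" by auto
  have "rev A \<preceq> \<Delta>" using Cons.prems by (intro atom_le_Delta) (simp add: atom_rev)
  then obtain z where z: "z \<in> Wd" "\<Delta> \<approx> rev A @ z" by (rule left_dvdE)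
  let ?c = "rev z"
  have "?c @ A \<approx> rev \<Delta>" using br_sym[OF br_rev[OF z(2)]] by simp
  then have c: "?c @ A \<approx> \<Delta>" using rev_Delta by (rule br_trans)
  have "atom S m ?c" using atom_br[OF br_sym[OF c] atom_Delta] by (rule atom_append)
  \<comment> \<open>c must stand next to A, and x then has to cross the \<Delta> formed by c A;
    hence \<open>map tau x\<close>.\<close>
  then have P: "atom_prod (length As + Suc 0) (map tau x @ ?c)"
    using x(1) by (intro atom_prod_append atom_prod_tau atom_prod_atom)
  have "(map tau x @ ?c) @ concat (A # As) \<approx> map tau x @ \<Delta> @ concat As"
    using br_context[OF c, of "map tau x" "concat As"] by simp
  also have "\<dots> \<approx> (\<Delta> @ x) @ concat As"
    using br_cong[OF br_sym[OF Delta_word[OF atom_prod_in_lists[OF x(1)]]] br_refl, of "concat As"] by simp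
  also have "\<dots> \<approx> Delta_pow (Suc (length As))"
    using br_cong[OF br_refl x(2), of \<Delta>] by (simp add: Delta_pow_Suc)
  finally show ?case using P by (auto simp del: atom_prod.simps)
qed auto

lemma atom_prod_Delta_pow: "atom_prod (n + i) (Delta_pow i @ x) \<Longrightarrow> atom_prod n x"
proof (induction i)
  case (Suc i)
  then have "atom_prod (Suc (n + i)) (\<Delta> @ Delta_pow i @ x)" by (simp add: Delta_pow_Suc del: atom_prod.simps)
  then show ?case using Suc.IH atom_prod_Delta by blast
qed simp

lemma length_Delta_pow: "length (Delta_pow n) = n * length \<Delta>"
  by (induction n) (auto simp: Delta_pow_Suc)

lemma length_concat_le:
  assumes "\<And>A. A \<in> set As \<Longrightarrow> length A \<le> k"
  shows "length (concat As) \<le> length As * k"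
  using assms by (induction As) (auto simp: add_mono)

lemma length_concat_ge:
  assumes "\<And>A. A \<in> set As \<Longrightarrow> A \<noteq> []"
  shows "length As \<le> length (concat As)"
  using assms
proof (induction As)
  case (Cons A As)
  then have "length A > 0" "length As \<le> length (concat As)" by auto
  then show ?case unfolding concat.simps length_append list.size by linarith
qed simp

text \<open>The words a, b, c stand for v, w, u. A special word g represents c^(-1) a up to a power
  of \<Delta> on the left; \<open>Delta_dichotomy\<close> for g decides whether p is compared with a
  or with b.\<close>

lemma geodesic_bound:
  assumes gw: "gw a" "gw b" "gw c" "gw p"
    and special: "special_nf S m (inv_word a @ b) As" and i: "i \<le> length As"
    and p: "coset_eq S m p (a @ pos (concat (take i As)))"
    and pa: "\<not> coset_eq S m p a" and pb: "\<not> coset_eq S m p b"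
  shows "d_at S m c p \<le> max (d_at S m c a) (d_at S m c b)
    \<and> d_wd S m c p < max (d_wd S m c a) (d_wd S m c b)
    \<and> int (d_wd S m c p) \<le> int (max (d_wd S m c a) (d_wd S m c b))
                              - int (min (d_at S m a p) (d_at S m b p))"
proof -
  let ?T = "take i As" and ?R = "drop i As"
  let ?M = "length As - i"
  have nf: "is_nf S m As" using special by (simp add: special_nf_def)
  have split: "concat As = concat ?T @ concat ?R" by (metis append_take_drop_id concat_append)
  have lists: "concat ?T \<in> Wd" "concat ?R \<in> Wd" using is_nf_in_lists[OF nf] split by auto
  obtain k where "pos (concat As) \<cong> (inv_word a @ b) @ dp k"
    using special by (auto simp: special_nf_def coset_eq_def)
  then have "inv_word a @ b \<cong> pos (concat As) @ dp (- k)" using art_move_dp art_sym by blast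
  then have b: "b \<cong> a @ pos (concat As) @ dp (- k)"
    using art_move_left[of "inv_word a"] gw by simp
  obtain l where "a @ pos (concat ?T) \<cong> p @ dp l" using p by (auto simp: coset_eq_def)
  then have p: "p \<cong> a @ pos (concat ?T) @ dp (- l)" using art_move_dp art_sym by (metis append.assoc)
  have "i \<noteq> 0"
  proof
    assume "i = 0"
    then have "a \<cong> p @ dp l" using p art_move_dp[of p l a] art_sym by simp
    with pa show False by (auto simp: coset_eq_def)
  qed
  have "i \<noteq> length As"
  proof
    assume "i = length As"
    then have "p \<cong> (a @ pos (concat As)) @ dp (- l)" using p by simp
    then have "p @ dp l \<cong> a @ pos (concat As)" using art_move_dp[of p l] by blast
    moreover have "b @ dp k \<cong> a @ pos (concat As)" using b art_move_dp[of b k] by simp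
    ultimately have "b @ dp k \<cong> p @ dp l" using art_trans art_sym by blast
    then have "b \<cong> p @ dp l @ dp (- k)" using art_move_dp[of b k "p @ dp l"] by simp
    also have "\<dots> \<cong> p @ dp (l - k)" using art_cong[OF art_refl art_sym[OF dp_add[of l "- k"]], of p] by simp
    finally show False using pb by (auto simp: coset_eq_def)
  qed
  with i have i': "i < length As" by simp
  have S: "S \<noteq> {}"
  proof -
    have "0 < length As" using i' by linarith
    then have "As ! 0 \<noteq> [] \<and> atom S m (As ! 0)" using nf is_nf_atoms[OF nf] by (auto simp: is_nf_def)
    then show ?thesis using atom_in_lists by fastforce
  qed
  have ap: "d_at S m a p \<le> i"
  proof -
    have "inv_word a @ p \<cong> dp 0 @ pos (concat ?T) @ dp (- l)"
      using art_sym[OF p] art_move_left[of a "pos (concat ?T) @ dp (- l)" p] gw by (auto intro: art_sym)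
    moreover have "atom_prod i (concat ?T)"
      using atom_prod_concat[of ?T] is_nf_atoms[OF nf] i by (auto dest: in_set_takeD)
    ultimately show ?thesis unfolding d_at_def using atomnorm_le[OF S] by blast
  qed
  \<comment> \<open>The atoms in \<open>?R\<close> lead from p to b, and their inverse is rewritten
    by \<open>left_complement\<close>.\<close>
  have bp: "d_at S m b p \<le> ?M"
  proof -
    obtain x where x: "atom_prod (length ?R) x" "x @ concat ?R \<approx> Delta_pow (length ?R)"
      using left_complement[of ?R] is_nf_atoms[OF nf] by (auto dest: in_set_dropD)
    let ?D = "dp (int ?M)"
    have xR: "pos x @ pos (concat ?R) \<cong> ?D" using br_art[OF x(2)] by (simp add: dp_nat)
    have "p @ dp l \<cong> a @ pos (concat ?T)" using p art_move_dp[of p l] by simp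
    then have "(p @ dp l) @ pos (concat ?R) \<cong> a @ pos (concat As)"
      using art_cong[OF _ art_refl, of "p @ dp l" "a @ pos (concat ?T)" "pos (concat ?R)"] split by simp
    also have "\<dots> \<cong> b @ dp k"
      using b art_move_dp[of b k "a @ pos (concat As)"] by (auto intro: art_sym)
    finally have "p @ dp l \<cong> (b @ dp k) @ inv_word (pos (concat ?R))"
      using art_move_right[of "pos (concat ?R)" "p @ dp l"] lists by simp
    moreover have "inv_word (pos (concat ?R)) \<cong> dp (- int ?M) @ pos x"
    proof -
      have "pos x \<cong> ?D @ inv_word (pos (concat ?R))"
        using xR art_move_right[of "pos (concat ?R)" "pos x"] lists by simp
      then have "dp (- int ?M) @ pos x \<cong> (dp (- int ?M) @ ?D) @ inv_word (pos (concat ?R))"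
        using art_cong[OF art_refl, of "pos x" _ "dp (- int ?M)"] by simp
      also have "\<dots> \<cong> inv_word (pos (concat ?R))"
        using art_cong[OF dp_dp_minus[of "- int ?M"] art_refl] by simp
      finally show ?thesis by (rule art_sym)
    qed
    ultimately have "p @ dp l \<cong> (b @ dp k) @ dp (- int ?M) @ pos x"
      using art_trans art_cong[OF art_refl] by blast
    also have "\<dots> \<cong> b @ dp (k - int ?M) @ pos x"
      using art_cong[OF art_refl art_cong[OF art_sym[OF dp_add[of k "- int ?M"]] art_refl], of b "pos x"] by simp
    finally have "p \<cong> b @ dp (k - int ?M) @ pos x @ dp (- l)" using art_move_dp[of p l] by simp
    then have "inv_word b @ p \<cong> dp (k - int ?M) @ pos x @ dp (- l)"
      using art_move_left[of b _ p] gw art_sym by blast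
    then show ?thesis unfolding d_at_def using atomnorm_le[OF S] x(1) by simp
  qed
  have "gw (inv_word c @ a)" using gw by simp
  then obtain j0 g0 where g0: "g0 \<in> Wd" "inv_word c @ a \<cong> dp j0 @ pos g0"
    by (rule group_word_form)
  obtain n0 g where g: "g \<in> Wd" "g0 \<approx> Delta_pow n0 @ g" "\<not> \<Delta> \<preceq> g" using strip_Delta[OF S g0(1)] .
  define j where "j = j0 + int n0"
  have merge: "dp e @ pos (Delta_pow n @ x) \<cong> dp (e + int n) @ pos x" for e n x
    using art_cong[OF art_sym[OF dp_add[of e "int n"]] art_refl, of "pos x"] by (simp add: dp_nat)
  have ca: "inv_word c @ a \<cong> dp j @ pos g"
    unfolding j_def using g0(2) art_cong[OF art_refl br_art[OF g(2)]] merge art_trans by blast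
  have from_c: "inv_word c @ q \<cong> dp (j + int n) @ pos h @ dp e"
    if q: "q \<cong> a @ pos x @ dp e" and x: "g @ x \<approx> Delta_pow n @ h" for q x e n h
  proof -
    have "inv_word c @ q \<cong> (inv_word c @ a) @ pos x @ dp e" using art_cong[OF art_refl q] by simp
    also have "\<dots> \<cong> (dp j @ pos g) @ pos x @ dp e" using ca by (rule art_cong) simp
    also have "\<dots> \<cong> (dp j @ pos (Delta_pow n @ h)) @ dp e"
      using art_context[OF br_art[OF x], of "dp j" "dp e"] by simp
    also have "\<dots> \<cong> (dp (j + int n) @ pos h) @ dp e" using merge by (rule art_cong) simp
    finally show ?thesis by simp
  qed
  have norm_a: "d_wd S m c a = length g"
    "\<And>n. d_at S m c a \<le> n \<longleftrightarrow> atom_prod n g"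
    using ca norms[OF S g(1) g(3), of "inv_word c @ a" j 0] unfolding d_wd_def d_at_def by simp_all
  from Delta_dichotomy[OF g(1) nf i] consider
      (gain) h where "h \<in> Wd" "g @ concat ?T \<approx> Delta_pow i @ h"
    | (const) n h where "h \<in> Wd" "g @ concat ?T \<approx> Delta_pow n @ h" "\<not> \<Delta> \<preceq> h @ concat ?R"
    by blast
  \<comment> \<open>The savings i and \<open>?M\<close> are positive and bound the atom distances
    from the ends to p, so either alternative gives both claims on d_wd.\<close>
  then have "(d_at S m c p \<le> d_at S m c a \<and> d_wd S m c p + i \<le> d_wd S m c a)
    \<or> (d_at S m c p \<le> d_at S m c b \<and> d_wd S m c p + ?M \<le> d_wd S m c b)"
  proof cases
    case gain
    obtain n u where u: "u \<in> Wd" "h \<approx> Delta_pow n @ u" "\<not> \<Delta> \<preceq> u" using strip_Delta[OF S gain(1)] .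
    have "inv_word c @ p \<cong> dp (j + int i) @ pos h @ dp (- l)" using from_c[OF p gain(2)] .
    also have "\<dots> \<cong> (dp (j + int i) @ pos (Delta_pow n @ u)) @ dp (- l)"
      using art_context[OF br_art[OF u(2)], of "dp (j + int i)" "dp (- l)"] by simp
    also have "\<dots> \<cong> (dp (j + int i + int n) @ pos u) @ dp (- l)" using merge by (rule art_cong) simp
    finally have norm_p: "d_wd S m c p = length u" "\<And>n. d_at S m c p \<le> n \<longleftrightarrow> atom_prod n u"
      using norms[OF S u(1) u(3), of "inv_word c @ p"] unfolding d_wd_def d_at_def by auto
    let ?n = "d_at S m c a"
    \<comment> \<open>i more atoms are allowed for the geodesic, and the i gained \<Delta>'s take
      them away again.\<close>
    have "atom_prod (?n + i) (g @ concat ?T)"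
      using norm_a(2)[of ?n] atom_prod_concat[of ?T] is_nf_atoms[OF nf] i
      by (intro atom_prod_append) (auto dest: in_set_takeD)
    then have "atom_prod (?n + i) (Delta_pow i @ h)" using atom_prod_br gain(2) by blast
    then have "atom_prod ?n h" by (rule atom_prod_Delta_pow)
    then have "atom_prod ?n u" using atom_prod_br[OF u(2)] atom_prod_right by blast
    then have at: "d_at S m c p \<le> ?n" using norm_p by simp
    \<comment> \<open>Atoms of a special normal form are proper divisors of \<Delta>, so i of them
      fall short of i \<Delta>'s by at least i letters, which g has to supply.\<close>
    have lt: "length A \<le> length \<Delta> - 1" if "A \<in> set ?T" for A
    proof -
      have A: "A \<in> set As" using that by (rule in_set_takeD)
      then have "\<not> pos A \<cong> pos \<Delta>" using special by (auto simp: special_nf_def in_set_conv_nth)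
      then have "\<not> \<Delta> \<preceq> A" "A \<preceq> \<Delta>" using A is_nf_atoms[OF nf] art_Delta_iff atom_le_Delta by auto
      then have "\<not> length \<Delta> \<le> length A"
        using left_dvd_length_eq[of A \<Delta>] br_left_dvd br_sym by blast
      then show ?thesis by simp
    qed
    have "length (concat ?T) \<le> i * (length \<Delta> - 1)"
      using length_concat_le[of ?T, OF lt] i by simp
    moreover have "\<Delta> \<noteq> []" using Delta_nonempty[OF S] by auto
    then have "i * length \<Delta> = i * (length \<Delta> - 1) + i" by (cases \<Delta>) auto
    ultimately have "length h + i \<le> length g"
      using br_length[OF gain(2)] by (simp add: length_Delta_pow)
    then have "d_wd S m c p + i \<le> d_wd S m c a"
      using br_length[OF u(2)] norm_p(1) norm_a(1) by simp
    with at show ?thesis by blast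
  next
    case const
    have h: "\<not> \<Delta> \<preceq> h" using const(3) left_dvd_trans left_dvd_append[OF lists(2)] by blast
    have norm_p: "d_wd S m c p = length h" "\<And>n. d_at S m c p \<le> n \<longleftrightarrow> atom_prod n h"
      using norms[OF S const(1) h from_c[OF p const(2)]] unfolding d_wd_def d_at_def by auto
    have hR: "h @ concat ?R \<in> Wd" using const(1) lists by simp
    have "g @ concat As \<approx> Delta_pow n @ h @ concat ?R"
      using br_cong[OF const(2) br_refl, of "concat ?R"] split by simp
    then have norm_b: "d_wd S m c b = length (h @ concat ?R)"
      "\<And>n. d_at S m c b \<le> n \<longleftrightarrow> atom_prod n (h @ concat ?R)"
      using norms[OF S hR const(3) from_c[OF b]] unfolding d_wd_def d_at_def by auto
    have "d_at S m c p \<le> d_at S m c b"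
      using norm_p(2) norm_b(2)[of "d_at S m c b"] atom_prod_left by blast
    \<comment> \<open>Each of the \<open>?M\<close> atoms after p adds at least one letter to
      h.\<close>
    moreover have "A \<noteq> []" if "A \<in> set As" for A
      using that nf by (auto simp: is_nf_def in_set_conv_nth)
    then have "?M \<le> length (concat ?R)"
      using length_concat_ge[of ?R] in_set_dropD by fastforce
    ultimately show ?thesis using norm_p(1) norm_b(1) by simp
  qed
  then show ?thesis using ap bp \<open>i \<noteq> 0\<close> i' by (auto simp: max_def min_def)
qed

end

theorem theorem3p11:
  fixes S :: "'a set" and m :: "'a \<Rightarrow> 'a \<Rightarrow> nat"
    and a b c p :: "('a \<times> bool) list" and As :: "'a list list" and i :: nat
  assumes "finite S" and "coxeter_matrix S m" and "finite_coxeter S m"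
    and "gword S a" and "gword S b" and "gword S c" and "gword S p"
    and "special_nf S m (inv_word a @ b) As"
    and "i \<le> length As"
    and "coset_eq S m p (a @ pos (concat (take i As)))"
    and "\<not> coset_eq S m p a" and "\<not> coset_eq S m p b"
  shows "d_at S m c p \<le> max (d_at S m c a) (d_at S m c b)
    \<and> d_wd S m c p < max (d_wd S m c a) (d_wd S m c b)
    \<and> int (d_wd S m c p) \<le> int (max (d_wd S m c a) (d_wd S m c b))
                              - int (min (d_at S m a p) (d_at S m b p))"
proof -
  interpret finite_coxeter_system S m
    using assms(2,3) by unfold_locales
  show ?thesis using geodesic_bound assms(4-12) .
qed

end
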